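(* Every clone $C$ on $\mathbb{Z}_8$ with $P(\mathbb{Z}_8,+)\subseteq C\subseteq M_1$ can be expressed as a join $$C(2t_{n_1})\vee C(2u_{n_2})\vee C(2v_{n_3})\vee C(2s_{n_4})\vee C(2p_{n_5})\vee C(2q_{n_6})\vee C(2r_{n_7})\vee C(4r_{n_8})$$ for suitable $n_1,\dots,n_8\in\{0,1,2,\dots\}\cup\{\infty\}$, where $n_i=0$ (and $n_3\in\{0,1\}$) means that the corresponding joinand is omitted (an empty join being $P(\mathbb{Z}_8,+)$), and $n_i=\infty$ means that the joinand is replaced by the join of the corresponding clones for all $n$ (e.g. $\bigvee_{n\ge1}C(2t_n)$).
   Context: All operations are on $\mathbb{Z}_8$; $\vee$ is the join in the lattice of clones on $\mathbb{Z}_8$. $P(\mathbb{Z}_8,+)$ is the clone of polynomial operations of the group $(\mathbb{Z}_8,+)$. For an operation $f$, $C(f)$ denotes the clone generated by $f$ together with binary addition and all unary constant operations. $P_4$ is the power set of $\{1,2,3,4\}$; for $A\in P_4$, $\mathbf{g}^A\in\mathbb{Z}_8^{P_4}$ has $B$-component $1$ if $A\subseteq B$ and $0$ otherwise; every $\mathbf{u}\in\mathbb{Z}_8^{P_4}$ has a unique expression $\mathbf{u}=\sum_{A\in P_4}a_A\mathbf{g}^A$, $a_A\in\mathbb{Z}_8$. $Z\subseteq\mathbb{Z}_8^{P_4}$ consists of all $\mathbf{u}$ with: (Z1) $a_{\{2\}}\equiv 2a_{\{1\}}\pmod 4$ and $a_{\{4\}}\equiv 2a_{\{3\}}\pmod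 4$; (Z2) $a_A\equiv0\pmod2$ whenever $|A|\ge2$; (Z3) $a_A\equiv 0\pmod 4$ whenever $|A|\ge2$ and $A\cap\{2,4\}\ne\emptyset$; (Z4) $a_A=0$ whenever $\{2,4\}\subseteq A$. $M_1$ is the clone of all polynomial operations of the ring $\mathbb{Z}_8$ that preserve $Z$ (componentwise). For $n\ge1$: $r_n=x_1\cdots x_n$; $t_n=x_1\cdots x_n(x_1+\dots+x_n)$ if $n$ is even and $t_n=x_1\cdots x_n(x_1+\dots+x_n+1)$ if $n$ is odd; $s_n=x_1\cdots x_n(x_1+\dots+x_n)$ if $n$ is odd and $s_n=x_1\cdots x_n(x_1+\dots+x_n+1)$ if $n$ is even; $p_n=x_1^2x_2\cdots x_n$; $q_n=x_1^3x_2\cdots x_n$; $u_n=x_1\cdots x_n(x_1+1)$; for $n\ge2$, $v_n=x_1\cdots x_n(x_1+x_2)$. *)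

theory Defs
  imports Main "HOL-Library.Numeral_Type" "HOL-Library.Extended_Nat"
begin

text \<open>Elements of Z_8 are the elements of the numeral type 8 (a commutative ring).
An n-ary operation (n >= 1) is a function (nat => 8) => 8 depending only on
the arguments with index < n (the variables x_1,...,x_n are x 0,...,x (n-1)).
A family of operations is a map from arities to sets of operations.\<close>

type_synonym op8 = "(nat \<Rightarrow> 8) \<Rightarrow> 8"
type_synonym opfam = "nat \<Rightarrow> op8 set"

definition ops :: "nat \<Rightarrow> op8 set" where
  "ops n = {f. 1 \<le> n \<and> (\<forall>x y. (\<forall>i<n. x i = y i) \<longrightarrow> f x = f y)}"

definition is_clone :: "opfam \<Rightarrow> bool" where
  "is_clone C \<longleftrightarrow>
     (\<forall>n. C n \<subseteq> ops n) \<and>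
     (\<forall>n i. i < n \<longrightarrow> (\<lambda>x. x i) \<in> C n) \<and>
     (\<forall>n m f g. f \<in> C n \<and> (\<forall>i<n. g i \<in> C m) \<longrightarrow> (\<lambda>x. f (\<lambda>i. g i x)) \<in> C m)"

definition clone_gen :: "opfam \<Rightarrow> opfam" where
  "clone_gen F = Inf {D. is_clone D \<and> F \<le> D}"

definition clone_join :: "opfam \<Rightarrow> opfam \<Rightarrow> opfam" (infixl "\<squnion>\<^sub>c" 65) where
  "clone_join C D = clone_gen (sup C D)"

definition clone_Join :: "opfam set \<Rightarrow> opfam" where
  "clone_Join S = clone_gen (Sup S)"

definition single_op :: "nat \<Rightarrow> op8 \<Rightarrow> opfam" where
  "single_op k f = (\<lambda>m. if m = k then {f} else {})"

definition add_op :: op8 where "add_op = (\<lambda>x. x 0 + x 1)"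
definition mult_op :: op8 where "mult_op = (\<lambda>x. x 0 * x 1)"
definition neg_op :: op8 where "neg_op = (\<lambda>x. - x 0)"

definition constants :: opfam where
  "constants = (\<lambda>m. if m = 1 then range (\<lambda>c::8. (\<lambda>x. c)) else {})"

definition P_add :: opfam where
  "P_add = clone_gen (sup (sup (single_op 2 add_op) (single_op 1 neg_op)) constants)"

definition P_ring :: opfam where
  "P_ring = clone_gen (sup (sup (sup (single_op 2 add_op) (single_op 2 mult_op))
                         (single_op 1 neg_op)) constants)"

definition Cgen :: "nat \<Rightarrow> op8 \<Rightarrow> opfam" where
  "Cgen k f = clone_gen (sup (sup (single_op k f) (single_op 2 add_op)) constants)"

text \<open>The set Z.  Vectors in Z_8^{P_4} are modelled as functions nat set => 8;
  the vector sum_A a_A g^A is the function B |-> sum over A in Pow {1..4} with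
  A subset of B of a_A.  (Components at B outside P_4 just repeat the component
  at B \<inter> {1..4}, so componentwise preservation is unaffected.)  Congruences mod 2, mod 4
  of elements of Z_8 are expressed by divisibility in the ring Z_8 (2 dvd x iff x even,
  4 dvd x iff x in {0,4}).\<close>
definition gvec :: "(nat set \<Rightarrow> 8) \<Rightarrow> (nat set \<Rightarrow> 8)" where
  "gvec a = (\<lambda>B. \<Sum>A\<in>Pow {1,2,3,4}. if A \<subseteq> B then a A else 0)"

definition Zset :: "(nat set \<Rightarrow> 8) set" where
  "Zset = {gvec a | a.
     (4 dvd (a {2} - 2 * a {1})) \<and> (4 dvd (a {4} - 2 * a {3})) \<and>
     (\<forall>A\<in>Pow {1,2,3,4}. 2 \<le> card A \<longrightarrow> 2 dvd a A) \<and>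
     (\<forall>A\<in>Pow {1,2,3,4}. 2 \<le> card A \<and> A \<inter> {2,4} \<noteq> {} \<longrightarrow> 4 dvd a A) \<and>
     (\<forall>A\<in>Pow {1,2,3,4}. {2,4} \<subseteq> A \<longrightarrow> a A = 0)}"

definition preserves_Z :: "nat \<Rightarrow> op8 \<Rightarrow> bool" where
  "preserves_Z n f \<longleftrightarrow>
     (\<forall>u :: nat \<Rightarrow> nat set \<Rightarrow> 8. (\<forall>i<n. u i \<in> Zset) \<longrightarrow> (\<lambda>B. f (\<lambda>i. u i B)) \<in> Zset)"

definition M1 :: opfam where
  "M1 = (\<lambda>n. {f \<in> P_ring n. preserves_Z n f})"

definition prodx :: "nat \<Rightarrow> op8" where "prodx n = (\<lambda>x. \<Prod>i<n. x i)"
definition sumx :: "nat \<Rightarrow> op8" where "sumx n = (\<lambda>x. \<Sum>i<n. x i)"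

definition r_op :: "nat \<Rightarrow> op8" where "r_op n = prodx n"
definition t_op :: "nat \<Rightarrow> op8" where
  "t_op n = (\<lambda>x. prodx n x * (sumx n x + (if even n then 0 else 1)))"
definition s_op :: "nat \<Rightarrow> op8" where
  "s_op n = (\<lambda>x. prodx n x * (sumx n x + (if odd n then 0 else 1)))"
definition p_op :: "nat \<Rightarrow> op8" where "p_op n = (\<lambda>x. x 0 * prodx n x)"
definition q_op :: "nat \<Rightarrow> op8" where "q_op n = (\<lambda>x. x 0 * x 0 * prodx n x)"
definition u_op :: "nat \<Rightarrow> op8" where "u_op n = (\<lambda>x. prodx n x * (x 0 + 1))"
definition v_op :: "nat \<Rightarrow> op8" where "v_op n = (\<lambda>x. prodx n x * (x 0 + x 1))"

definition scal :: "8 \<Rightarrow> (nat \<Rightarrow> op8) \<Rightarrow> (nat \<Rightarrow> op8)" where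
  "scal c f = (\<lambda>n x. c * f n x)"

text \<open>Joinand for parameter N :: enat with family f defined for arities >= lo:
  N < lo: omitted (contributes P(Z_8,+)); finite N >= lo: C(f_N);
  N = infinity: join of C(f_k) over all k >= lo.\<close>
definition joinand :: "nat \<Rightarrow> (nat \<Rightarrow> op8) \<Rightarrow> enat \<Rightarrow> opfam" where
  "joinand lo f N =
     (if N = \<infinity> then clone_Join {Cgen k (f k) | k. lo \<le> k}
      else if N < enat lo then P_add
      else Cgen (the_enat N) (f (the_enat N)))"

end

theory Submission
  imports Defs "HOL-Combinatorics.Permutations"
begin

text \<open>
  Testing preservation of Z on vectors with coefficients c, a, 2a, b, 2b at the sets
  {}, {1}, {2}, {3}, {4} shows that every operation in M1 is affine up to an even-valued
  summand F, and that F (c + 2a) is congruent to F c mod 4 and additive in a modulo 8.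
  Splitting off restrictions F (x_k = 0), we may assume that F vanishes as soon as one argument is 0.
  Such an F is determined by its values at (1,...,1) and at the points obtained from it by changing
  one coordinate to 2 or 3, so F has the form
    2 x_1...x_m (a + sum_{i in B} (x_i - 1) + sum_{i in K} (x_i - 1) x_i).
  The substitutions x_k + 1, x_k + 2, x_k + x_{m+1} and transpositions of variables extract from F
  special operations (multiples of t, u, v, s, p, q, r) from which F can be rebuilt. Hence every
  clone below M1 is generated by the special operations that it contains, and the arities for which
  it contains a given kind are downward closed.
\<close>

section \<open>Arithmetic in Z_8\<close>

lemma of_nat_8_cases:
  fixes x :: 8
  obtains k :: nat where "x = of_nat k" "k < 8"
proof (cases x rule: bit0_cases)
  fix z :: int
  assume "x = of_int z" "0 \<le> z" "z < int CARD(8)"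
  then show ?thesis by (intro that[of "nat z"]) auto
qed

text \<open>A quantifier over Z_8 becomes eight numeral instances that \<open>simp\<close>
  evaluates. Facts special to Z_8 are decided this way below.\<close>

lemma forall_8: "(\<forall>x::8. P x) \<longleftrightarrow> (\<forall>x\<in>{0,1,2,3,4,5,6,7}. P x)"
proof -
  have "x \<in> {0,1,2,3,4,5,6,7}" for x :: 8
  proof -
    obtain k where "x = of_nat k" "k < 8" by (rule of_nat_8_cases)
    moreover from this have "k \<in> {0,1,2,3,4,5,6,7}" by auto
    ultimately show ?thesis by auto
  qed
  then show ?thesis by blast
qed

text \<open>The quotient \<open>b\<close> is a natural number so that even steps can later be added
  up by induction.\<close>

lemma parity_decomp_8:
  fixes x :: 8
  obtains e and b :: nat where "e \<in> {0, 1}" "x = e + 2 * of_nat b"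
proof -
  have "\<forall>x::8. \<exists>e\<in>{0, 1}. \<exists>b\<in>{0,1,2,3::nat}. x = e + 2 * of_nat b"
    unfolding forall_8 by simp
  then show ?thesis using that by blast
qed

lemma eight_mult [simp]: "8 * (x::8) = 0"
proof -
  have "\<forall>x::8. 8 * x = 0" unfolding forall_8 by simp
  then show ?thesis ..
qed

lemma four_dvd_8: "(4::8) dvd x \<longleftrightarrow> x = 0 \<or> x = 4"
proof -
  have "\<forall>y::8. 4 * y = 0 \<or> 4 * y = 4" unfolding forall_8 by simp
  moreover have "4 dvd 4 * (0::8)" "4 dvd 4 * (1::8)" by (rule dvd_triv_left)+
  ultimately show ?thesis by (auto elim: dvdE)
qed

lemma four_mult_even_8: "2 dvd x \<Longrightarrow> 4 dvd 2 * (x::8)"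
  using mult_dvd_mono[of 2 2 2 x] by simp

section \<open>Consequences of preserving Z\<close>

text \<open>At a small set \<open>B\<close> only few coefficients remain, so coefficients can be
  recovered as differences of components.\<close>

lemma gvec_eq_sum_Pow: "gvec a B = sum a (Pow (B \<inter> {1,2,3,4}))"
proof -
  have "Pow (B \<inter> {1,2,3,4}) = {A \<in> Pow {1,2,3,4}. A \<subseteq> B}" by auto
  moreover have "gvec a B = sum a {A \<in> Pow {1,2,3,4}. A \<subseteq> B}"
    unfolding gvec_def by (rule sum.inter_filter[symmetric]) (simp only: finite_Pow_iff finite.intros)
  ultimately show ?thesis by (simp only:)
qed

text \<open>The coefficients of the image of a test vector are alternating sums of values of
  \<open>f\<close>. The three claims are (Z1) at {1} and {2}, (Z2) at {1,3} and (Z4) at {2,4} for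
  these coefficients.\<close>

lemma preserves_Z_differences:
  assumes "preserves_Z n f"
  shows "4 dvd f (\<lambda>i. c i + 2 * a i) - f c - 2 * (f (\<lambda>i. c i + a i) - f c)"
    and "2 dvd f (\<lambda>i. c i + a i + b i) - f (\<lambda>i. c i + a i) - f (\<lambda>i. c i + b i) + f c"
    and "f (\<lambda>i. c i + 2 * a i + 2 * b i) = f (\<lambda>i. c i + 2 * a i) + f (\<lambda>i. c i + 2 * b i) - f c"
proof -
  \<comment> \<open>The doubled entries at {2} and {4} satisfy (Z1) with equality. The other
    conditions hold since all coefficients at sets with two or more elements are 0.\<close>
  define w where "w i = (\<lambda>A::nat set. if A = {} then c i else if A = {1} then a i
    else if A = {2} then 2 * a i else if A = {3} then b i else if A = {4} then 2 * b i else 0)" for i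
  have big: "w i A = 0" if "2 \<le> card A" for i A
    using that by (auto simp: w_def)
  have "gvec (w i) \<in> Zset" for i
    unfolding Zset_def mem_Collect_eq
  proof (intro exI[of _ "w i"] conjI ballI impI)
    show "w i A = 0" if "A \<in> Pow {1,2,3,4}" "{2,4} \<subseteq> A" for A
    proof (rule big)
      have "card {2, 4::nat} \<le> card A"
        using that by (intro card_mono) (auto intro: finite_subset)
      then show "2 \<le> card A" by simp
    qed
    show "4 dvd w i {2} - 2 * w i {1}" "4 dvd w i {4} - 2 * w i {3}"
      by (simp_all add: w_def)
    show "2 dvd w i A" if "2 \<le> card A" for A
      using big[OF that] by simp
    show "4 dvd w i A" if "2 \<le> card A \<and> A \<inter> {2,4} \<noteq> {}" for A
      using big[of A i] that by simp
  qed (rule refl)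
  then have "(\<lambda>B. f (\<lambda>i. gvec (w i) B)) \<in> Zset"
    using assms unfolding preserves_Z_def by (elim allE[of _ "\<lambda>i. gvec (w i)"]) auto
  then obtain v where V: "(\<lambda>B. f (\<lambda>i. gvec (w i) B)) = gvec v \<and>
     (4 dvd (v {2} - 2 * v {1})) \<and> (4 dvd (v {4} - 2 * v {3})) \<and>
     (\<forall>A\<in>Pow {1,2,3,4}. 2 \<le> card A \<longrightarrow> 2 dvd v A) \<and>
     (\<forall>A\<in>Pow {1,2,3,4}. 2 \<le> card A \<and> A \<inter> {2,4} \<noteq> {} \<longrightarrow> 4 dvd v A) \<and>
     (\<forall>A\<in>Pow {1,2,3,4}. {2,4} \<subseteq> A \<longrightarrow> v A = 0)"
    unfolding Zset_def mem_Collect_eq by (elim exE)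
  have v: "(\<lambda>B. f (\<lambda>i. gvec (w i) B)) = gvec v" and z1: "4 dvd v {2} - 2 * v {1}"
    by (rule V[THEN conjunct1], rule V[THEN conjunct2, THEN conjunct1])
  have z13: "2 dvd v {1, 3}"
    using V[THEN conjunct2, THEN conjunct2, THEN conjunct2, THEN conjunct1, THEN bspec, of "{1,3}"] by simp
  have z24: "v {2, 4} = 0"
    using V[THEN conjunct2, THEN conjunct2, THEN conjunct2, THEN conjunct2, THEN conjunct2, THEN bspec, of "{2,4}"]
    by simp
  have fB: "f (\<lambda>i. gvec (w i) B) = gvec v B" for B
    using v by (rule fun_cong)
  have Pow2: "sum g (Pow {p, q}) = g {} + g {p} + g {q} + g {p, q}"
    if "p \<noteq> q" for g :: "nat set \<Rightarrow> 8" and p q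
    using that by (simp add: Pow_insert doubleton_eq_iff add_ac)
  have g0: "gvec g {} = g {}" for g by (simp add: gvec_eq_sum_Pow)
  have g1: "gvec g {p} = g {} + g {p}" if "p \<in> {1,2,3,4}" for g p
    using that by (simp add: gvec_eq_sum_Pow Pow_insert add_ac)
  have g2: "gvec g {p, q} = g {} + g {p} + g {q} + g {p, q}"
    if "p \<in> {1,2,3,4}" "q \<in> {1,2,3,4}" "p \<noteq> q" for g p q
  proof -
    have "{p, q} \<inter> {1,2,3,4} = {p, q}" using that by auto
    then show ?thesis using that by (simp add: gvec_eq_sum_Pow Pow2)
  qed
  have f0: "f c = v {}" using fB[of "{}"] by (simp add: g0 w_def)
  have f1: "f (\<lambda>i. c i + a i) = v {} + v {1}" using fB[of "{1}"] by (simp add: g1 w_def)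
  have f2: "f (\<lambda>i. c i + 2 * a i) = v {} + v {2}" using fB[of "{2}"] by (simp add: g1 w_def)
  have f3: "f (\<lambda>i. c i + b i) = v {} + v {3}" using fB[of "{3}"] by (simp add: g1 w_def)
  have f4: "f (\<lambda>i. c i + 2 * b i) = v {} + v {4}" using fB[of "{4}"] by (simp add: g1 w_def)
  have f13: "f (\<lambda>i. c i + a i + b i) = v {} + v {1} + v {3} + v {1,3}"
    using fB[of "{1,3}"] by (simp add: g2 w_def)
  have f24: "f (\<lambda>i. c i + 2 * a i + 2 * b i) = v {} + v {2} + v {4} + v {2,4}"
    using fB[of "{2,4}"] by (simp add: g2 w_def)
  show "4 dvd f (\<lambda>i. c i + 2 * a i) - f c - 2 * (f (\<lambda>i. c i + a i) - f c)"
    using z1 by (simp add: f0 f1 f2)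
  show "2 dvd f (\<lambda>i. c i + a i + b i) - f (\<lambda>i. c i + a i) - f (\<lambda>i. c i + b i) + f c"
    using z13 by (simp add: f0 f1 f3 f13)
  show "f (\<lambda>i. c i + 2 * a i + 2 * b i) = f (\<lambda>i. c i + 2 * a i) + f (\<lambda>i. c i + 2 * b i) - f c"
    using z24 by (simp add: f0 f2 f4 f24)
qed

lemma opsD: "f \<in> ops n \<Longrightarrow> (\<And>i. i < n \<Longrightarrow> x i = y i) \<Longrightarrow> f x = f y"
  by (auto simp: ops_def)

definition unit_vec :: "nat \<Rightarrow> nat \<Rightarrow> 8" where
  "unit_vec i = (\<lambda>j. if j = i then 1 else 0)"

text \<open>Modulo 2, \<open>f\<close> is additive up to a constant. Subtracting the affine function
  that agrees with \<open>f\<close> at 0 and at the unit vectors leaves a function that is even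
  there, hence on all sums of unit vectors.\<close>

lemma affine_mod_2:
  assumes ops: "f \<in> ops n"
    and bilin: "\<And>a b. 2 dvd f (\<lambda>i. a i + b i) - f a - f b + f (\<lambda>_. 0)"
  obtains k m where "\<And>x. 2 dvd f x - (k + (\<Sum>i<n. m i * x i))"
proof -
  define k where "k = f (\<lambda>_. 0)"
  define m where "m i = f (unit_vec i) - k" for i
  define F where "F x = f x - (k + (\<Sum>i<n. m i * x i))" for x
  have F0: "F (\<lambda>_. 0) = 0" by (simp add: F_def k_def)
  have add: "2 dvd F (\<lambda>i. a i + b i)" if "2 dvd F a" "2 dvd F b" for a b
  proof -
    have "F (\<lambda>i. a i + b i) = F a + F b + (f (\<lambda>i. a i + b i) - f a - f b + f (\<lambda>_. 0))"
      by (simp add: F_def k_def algebra_simps sum.distrib)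
    then show ?thesis using that bilin by simp
  qed
  have unit: "2 dvd F (unit_vec i)" if "i < n" for i
  proof -
    have "(\<Sum>j<n. m j * unit_vec i j) = m i"
      using that by (simp add: unit_vec_def if_distrib cong: if_cong)
    then show ?thesis by (simp add: F_def m_def)
  qed
  have mult: "2 dvd F (\<lambda>j. of_nat k * unit_vec i j)" if "i < n" for i k
  proof (induction k)
    case 0
    then show ?case using F0 by simp
  next
    case (Suc k)
    then show ?case using add[OF unit[OF that] Suc] by (simp add: algebra_simps)
  qed
  have single: "2 dvd F (\<lambda>j. y * unit_vec i j)" if "i < n" for i y
    using mult[OF that] by (cases y rule: of_nat_8_cases) simp
  have part: "2 dvd F (\<lambda>j. if j < l then x j else 0)" if "l \<le> n" for l x
    using that
  proof (induction l)
    case 0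
    then show ?case using F0 by simp
  next
    case (Suc l)
    have "(\<lambda>j. if j < Suc l then x j else 0) =
        (\<lambda>j. (if j < l then x j else 0) + x l * unit_vec l j)"
      by (auto simp: unit_vec_def fun_eq_iff less_Suc_eq)
    then show ?case using Suc single[of l "x l"] by (simp add: add)
  qed
  have "2 dvd F x" for x
  proof -
    have "F x = F (\<lambda>j. if j < n then x j else 0)"
      using opsD[OF ops, of x "\<lambda>j. if j < n then x j else 0"] by (simp add: F_def)
    then show ?thesis using part[of n x] by simp
  qed
  then show ?thesis by (intro that) (simp add: F_def)
qed

section \<open>Clones containing the polynomials of the group\<close>

lemma clone_gen_upper: "F \<le> clone_gen F"
  unfolding clone_gen_def by (rule Inf_greatest) blast

lemma clone_gen_least: "is_clone D \<Longrightarrow> F \<le> D \<Longrightarrow> clone_gen F \<le> D"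
  unfolding clone_gen_def by (rule Inf_lower) blast

lemma clone_gen_iff: "f \<in> clone_gen F n \<longleftrightarrow> (\<forall>D. is_clone D \<and> F \<le> D \<longrightarrow> f \<in> D n)"
  by (auto simp: clone_gen_def)

text \<open>The clone \<open>C\<close> above \<open>F\<close> keeps the infimum from ranging over
  the empty set, which would give the full family and violate the bound by
  \<open>ops\<close>.\<close>

lemma is_clone_clone_gen:
  assumes "is_clone C" "F \<le> C"
  shows "is_clone (clone_gen F)"
  unfolding is_clone_def
proof (intro conjI allI impI)
  show "clone_gen F n \<subseteq> ops n" for n
  proof -
    have "C n \<subseteq> ops n" using assms(1) by (simp add: is_clone_def)
    then show ?thesis using assms by (auto simp: clone_gen_iff)
  qed
  show "(\<lambda>x. x i) \<in> clone_gen F n" if "i < n" for n i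
    using that by (auto simp: clone_gen_iff is_clone_def)
  show "(\<lambda>x. f (\<lambda>i. g i x)) \<in> clone_gen F m"
    if "f \<in> clone_gen F n \<and> (\<forall>i<n. g i \<in> clone_gen F m)" for n m f g
    unfolding clone_gen_iff
  proof (intro allI impI)
    fix D assume D: "is_clone D \<and> F \<le> D"
    with that have "f \<in> D n" "\<forall>i<n. g i \<in> D m" by (auto simp: clone_gen_iff)
    with D show "(\<lambda>x. f (\<lambda>i. g i x)) \<in> D m" unfolding is_clone_def by blast
  qed
qed

lemma is_clone_comp:
  assumes "is_clone C" "f \<in> C n" "\<And>i. i < n \<Longrightarrow> (\<lambda>x. g x i) \<in> C m"
  shows "(\<lambda>x. f (g x)) \<in> C m"
proof -
  have "\<forall>n m f g. f \<in> C n \<and> (\<forall>i<n. g i \<in> C m) \<longrightarrow> (\<lambda>x. f (\<lambda>i. g i x)) \<in> C m"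
    using assms(1) unfolding is_clone_def by (elim conjE)
  from this[THEN spec, THEN spec, THEN spec, THEN spec, of f n "\<lambda>i x. g x i" m]
  show ?thesis using assms(2,3) by simp
qed

text \<open>Sets replace coefficients because doubling a summand from \<open>B\<close> or
  \<open>K\<close> gives 0: \<open>4 * x * (x - 1)\<close> vanishes in Z_8. At the point with all
  coordinates 1 except one equal to 2, only \<open>B\<close> contributes; with 3 in place of 2, both
  \<open>B\<close> and \<open>K\<close> do.\<close>

definition nf :: "nat \<Rightarrow> 8 \<Rightarrow> nat set \<Rightarrow> nat set \<Rightarrow> op8" where
  "nf m a B K = (\<lambda>x. 2 * prodx m x * (a + (\<Sum>i\<in>B. x i - 1) + (\<Sum>i\<in>K. (x i - 1) * x i)))"

lemma prodx_split:
  assumes "k < m"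
  shows "prodx m x = x k * (\<Prod>i\<in>{..<m}-{k}. x i)"
  unfolding prodx_def using assms by (simp add: prod.remove)

text \<open>Isolates the coordinate \<open>k\<close>: \<open>p\<close> and \<open>s\<close> collect
  the factors and summands free of it and do not depend on \<open>y\<close>. Substitutions for
  \<open>x k\<close> thereby become the identities in few variables that follow.\<close>

lemma nf_upd:
  assumes "k < m" "B \<subseteq> {..<m}" "K \<subseteq> {..<m}"
  shows "\<exists>p s. \<forall>y. prodx m (x(k := y)) = y * p \<and> nf m a B K (x(k := y)) =
    2 * (y * p) * (s + (if k \<in> B then y - 1 else 0) + (if k \<in> K then (y - 1) * y else 0))"
proof (intro exI allI conjI)
  define p where "p = (\<Prod>i\<in>{..<m}-{k}. x i)"
  define s where "s = a + (\<Sum>i\<in>B-{k}. x i - 1) + (\<Sum>i\<in>K-{k}. (x i - 1) * x i)"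
  have fin: "finite B" "finite K" using assms(2,3) finite_subset by blast+
  show prodx: "prodx m (x(k := y)) = y * p" for y
    using prodx_split[OF assms(1), of "x(k := y)"] by (simp add: p_def)
  have sum: "(\<Sum>i\<in>A. g ((x(k := y)) i)) = (if k \<in> A then g y else 0) + (\<Sum>i\<in>A-{k}. g (x i))"
    if "finite A" for A y and g :: "8 \<Rightarrow> 8"
  proof -
    have "(\<Sum>i\<in>A-{k}. g ((x(k := y)) i)) = (\<Sum>i\<in>A-{k}. g (x i))" by simp
    then show ?thesis using that by (cases "k \<in> A") (simp_all add: sum.remove)
  qed
  show "nf m a B K (x(k := y)) =
      2 * (y * p) * (s + (if k \<in> B then y - 1 else 0) + (if k \<in> K then (y - 1) * y else 0))" for y
    unfolding nf_def prodx sum[OF fin(1), of "\<lambda>z. z - 1"] sum[OF fin(2), of "\<lambda>z. (z - 1) * z"]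
    by (simp add: s_def add_ac)
qed

section \<open>Identities modulo 8 behind substitutions into one coordinate\<close>

lemma four_idem_8: "4 * (x::8) * x = 4 * x"
proof -
  have "\<forall>x::8. 4 * x * x = 4 * x" unfolding forall_8 by simp
  then show ?thesis ..
qed

text \<open>The three terms are the normal form with coordinate \<open>k\<close> in \<open>K\<close>
  set to \<open>x + 2\<close>, \<open>2\<close> and \<open>x\<close>; \<open>b\<close> stands for
  the indicator of \<open>k\<close> in \<open>B\<close>.\<close>

lemma shift_two_8:
  "2 * ((x + 2) * p) * (s + b * (x + 1) + (x + 1) * (x + 2)) - 2 * (2 * p) * (s + b + 2)
    - 2 * (x * p) * (s + b * (x - 1) + (x - 1) * x) = 4 * (x * (p::8))" (is "?L = _")
proof -
  have "?L = 4 * (x * p) + 8 * (b * x * p + x * x * p + 2 * x * p) + (4 * x * x - 4 * x) * p"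
    by (simp add: algebra_simps)
  then show ?thesis by (simp add: four_idem_8)
qed

text \<open>As before with \<open>x + 1\<close>, \<open>1\<close> and \<open>x\<close>; now
  \<open>b\<close> and \<open>c\<close> stand for the indicators of \<open>B\<close> and
  \<open>K\<close>.\<close>

lemma shift_one_8:
  "2 * ((x + 1) * p) * (s + b * x + c * (x * (x + 1))) - 2 * (1 * p) * s
    - 2 * (x * p) * (s + b * (x - 1) + c * ((x - 1) * x))
    = 4 * b * (x * p) + c * (2 * (x * p) * ((x::8) - 1))" (is "?L = ?R")
proof -
  have "?L = ?R + 8 * (c * x * p) + (4 * x * x - 4 * x) * (p * c)"
    by (simp add: algebra_simps)
  then show ?thesis by (simp add: four_idem_8)
qed

text \<open>The deviation from additivity when coordinate \<open>k\<close> in \<open>K\<close>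
  becomes a sum of two variables; \<open>y\<close> plays the part of a fresh variable.\<close>

lemma split_8:
  "2 * ((x + y) * p) * (s + b * (x + y - 1) + (x + y - 1) * (x + y))
    - 2 * (x * p) * (s + b * (x - 1) + (x - 1) * x)
    - 2 * (y * p) * (s + b * (y - 1) + (y - 1) * y)
    = 2 * (x * p * y) * (2 * b + ((x - 1) + ((y::8) - 1)))" (is "?L = ?R")
proof -
  have "?L = ?R + 8 * (x * y * p) + (4 * x * x - 4 * x) * (p * y) + (4 * y * y - 4 * y) * (p * x)"
    by (simp add: algebra_simps)
  then show ?thesis by (simp add: four_idem_8)
qed

text \<open>Both \<open>x * (x - 1)\<close> and \<open>y * (y - 1)\<close> are even, so together
  with the factor 2 the product is divisible by 8.\<close>

lemma two_falling_8: "2 * (x * y) * (((x::8) - 1) * (y - 1)) = 0"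
proof -
  have "\<forall>x::8. \<forall>y::8. 2 * (x * y) * ((x - 1) * (y - 1)) = 0" unfolding forall_8 by simp
  then show ?thesis by blast
qed

text \<open>Clones above the polynomial clone of the group. The given clone, the clones
  \<open>Cgen\<close> and the join of the joinands are all treated as instances.\<close>

locale pclone =
  fixes C :: opfam
  assumes is_clone: "is_clone C" and P_add_le: "P_add \<le> C"
begin

lemma in_ops: "f \<in> C n \<Longrightarrow> f \<in> ops n"
  using is_clone by (auto simp: is_clone_def)

lemma arity_pos: "f \<in> C n \<Longrightarrow> 1 \<le> n"
  using in_ops by (auto simp: ops_def)

lemma proj [intro]: "i < n \<Longrightarrow> (\<lambda>x. x i) \<in> C n"
  using is_clone by (auto simp: is_clone_def)

lemma comp:
  "f \<in> C n \<Longrightarrow> (\<And>i. i < n \<Longrightarrow> (\<lambda>x. g x i) \<in> C m) \<Longrightarrow> (\<lambda>x. f (g x)) \<in> C m"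
  by (rule is_clone_comp[OF is_clone])

lemma generators: "add_op \<in> C 2" "neg_op \<in> C 1" "(\<lambda>x. c) \<in> C 1"
proof -
  have *: "sup (sup (single_op 2 add_op) (single_op 1 neg_op)) constants \<le> C"
    using clone_gen_upper P_add_le unfolding P_add_def by (rule order_trans)
  then have "single_op 2 add_op 2 \<subseteq> C 2" "single_op 1 neg_op 1 \<subseteq> C 1" "constants 1 \<subseteq> C 1"
    by (auto simp: le_fun_def)
  then show "add_op \<in> C 2" "neg_op \<in> C 1" "(\<lambda>x. c) \<in> C 1"
    by (auto simp: single_op_def constants_def)
qed

lemma const: "1 \<le> n \<Longrightarrow> (\<lambda>x. c) \<in> C n"
  using comp[OF generators(3), of "\<lambda>x i. x i" n c] proj by simp

lemma add:
  assumes "f \<in> C n" "g \<in> C n"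
  shows "(\<lambda>x. f x + g x) \<in> C n"
proof -
  have "(\<lambda>x. add_op (\<lambda>i. if i = 0 then f x else g x)) \<in> C n"
  proof (rule comp[OF generators(1)])
    show "(\<lambda>x. if i = 0 then f x else g x) \<in> C n" for i :: nat
      using assms by (cases "i = 0") simp_all
  qed
  then show ?thesis by (simp add: add_op_def)
qed

lemma neg: "f \<in> C n \<Longrightarrow> (\<lambda>x. - f x) \<in> C n"
  using comp[OF generators(2), of "\<lambda>x i. f x" n] by (simp add: neg_op_def)

lemma diff: "f \<in> C n \<Longrightarrow> g \<in> C n \<Longrightarrow> (\<lambda>x. f x - g x) \<in> C n"
  using add[OF _ neg, of f n g] by simp

lemma scale:
  assumes "f \<in> C n"
  shows "(\<lambda>x. c * f x) \<in> C n"
proof -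
  have "(\<lambda>x. of_nat k * f x) \<in> C n" for k
  proof (induction k)
    case 0
    then show ?case using const[OF arity_pos[OF assms]] by simp
  next
    case (Suc k)
    then show ?case using add[OF assms Suc] by (simp add: algebra_simps)
  qed
  then show ?thesis by (cases c rule: of_nat_8_cases) simp
qed

lemma sum:
  assumes "1 \<le> n" "\<And>i. i \<in> A \<Longrightarrow> f i \<in> C n"
  shows "(\<lambda>x. \<Sum>i\<in>A. f i x) \<in> C n"
  using assms(2)
proof (induction A rule: infinite_finite_induct)
  case (insert i A)
  then show ?case by (simp add: add)
qed (use const[OF assms(1)] in simp_all)

lemma subst_upd:
  assumes "f \<in> C n" "n \<le> m" "t \<in> C m"
  shows "(\<lambda>x. f (x(k := t x))) \<in> C m"
proof (rule comp[OF assms(1)])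
  show "(\<lambda>x. (x(k := t x)) i) \<in> C m" if "i < n" for i
    using that assms(2,3) by (cases "i = k") auto
qed

lemma subst_transpose:
  assumes "f \<in> C m" "k < m" "l < m"
  shows "(\<lambda>x. f (\<lambda>i. x (transpose k l i))) \<in> C m"
proof (rule comp[OF assms(1)])
  show "(\<lambda>x. x (transpose k l i)) \<in> C m" if "i < m" for i
    using that assms(2,3) by (intro proj) (simp add: transpose_def)
qed

end

lemma prodx_transpose:
  assumes "k < m" "l < m"
  shows "prodx m (\<lambda>i. x (transpose k l i)) = prodx m x"
proof -
  have "transpose k l permutes {..<m}" using assms by (intro permutes_swap_id) auto
  then show ?thesis unfolding prodx_def using prod.permute[of _ "{..<m}" x] by (simp add: o_def)
qed

section \<open>Extracting special operations from a normal form\<close>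

context pclone begin

text \<open>The part linear in \<open>x k\<close> cancels in
  \<open>f (x k + 2) - f 2 - f (x k)\<close>, the part from \<open>B\<close> vanishes modulo 8, and
  the part from \<open>K\<close> leaves exactly \<open>4 * prodx m x\<close>.\<close>

lemma nf_4r_of_K:
  assumes "nf m a B K \<in> C m" "B \<subseteq> {..<m}" "K \<subseteq> {..<m}" "k \<in> K"
  shows "(\<lambda>x. 4 * prodx m x) \<in> C m"
proof -
  have "k < m" using assms by auto
  have "(\<lambda>x. nf m a B K (x(k := x k + 2)) - nf m a B K (x(k := 2)) - nf m a B K x) \<in> C m"
    using \<open>k < m\<close> arity_pos[OF assms(1)]
    by (intro diff subst_upd[OF assms(1)] add proj const assms(1)) auto
  moreover have "nf m a B K (x(k := x k + 2)) - nf m a B K (x(k := 2)) - nf m a B K x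
      = 4 * prodx m x" for x
  proof -
    obtain p s where ps: "\<forall>y. prodx m (x(k := y)) = y * p \<and> nf m a B K (x(k := y)) =
        2 * (y * p) * (s + (if k \<in> B then y - 1 else 0) + (if k \<in> K then (y - 1) * y else 0))"
      using nf_upd[OF \<open>k < m\<close> assms(2,3), where x = x and a = a] by (elim exE)
    note p = ps[THEN spec, THEN conjunct1] and s = ps[THEN spec, THEN conjunct2]
    have "nf m a B K (x(k := x k + 2)) - nf m a B K (x(k := 2)) - nf m a B K (x(k := x k)) =
        4 * prodx m (x(k := x k))"
      unfolding s p using shift_two_8[of "x k" p s "if k \<in> B then 1 else 0"] \<open>k \<in> K\<close>
      by (cases "k \<in> B") (simp_all add: add_ac)
    then show ?thesis by simp
  qed
  ultimately show ?thesis by simp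
qed

text \<open>The same difference with step 1 also registers \<open>B\<close>: the quadratic part in
  \<open>x k\<close> contributes \<open>4 * prodx m x\<close>, the cubic part an operation with
  factor \<open>x k - 1\<close>.\<close>

lemma nf_shift_one:
  assumes "nf m a B K \<in> C m" "B \<subseteq> {..<m}" "K \<subseteq> {..<m}" "k < m"
  shows "(\<lambda>x. (if k \<in> B then 4 * prodx m x else 0) +
    (if k \<in> K then 2 * prodx m x * (x k - 1) else 0)) \<in> C m"
proof -
  have "(\<lambda>x. nf m a B K (x(k := x k + 1)) - nf m a B K (x(k := 1)) - nf m a B K x) \<in> C m"
    using \<open>k < m\<close> arity_pos[OF assms(1)]
    by (intro diff subst_upd[OF assms(1)] add proj const assms(1)) auto
  moreover have "nf m a B K (x(k := x k + 1)) - nf m a B K (x(k := 1)) - nf m a B K x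
      = (if k \<in> B then 4 * prodx m x else 0) + (if k \<in> K then 2 * prodx m x * (x k - 1) else 0)" for x
  proof -
    obtain p s where ps: "\<forall>y. prodx m (x(k := y)) = y * p \<and> nf m a B K (x(k := y)) =
        2 * (y * p) * (s + (if k \<in> B then y - 1 else 0) + (if k \<in> K then (y - 1) * y else 0))"
      using nf_upd[OF \<open>k < m\<close> assms(2,3), where x = x and a = a] by (elim exE)
    note p = ps[THEN spec, THEN conjunct1] and s = ps[THEN spec, THEN conjunct2]
    have "nf m a B K (x(k := x k + 1)) - nf m a B K (x(k := 1)) - nf m a B K (x(k := x k)) =
       (if k \<in> B then 4 * prodx m (x(k := x k)) else 0) +
       (if k \<in> K then 2 * prodx m (x(k := x k)) * (x k - 1) else 0)"
      unfolding s p
      using shift_one_8[of "x k" p s "if k \<in> B then 1 else 0" "if k \<in> K then 1 else 0"]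
      by (cases "k \<in> B"; cases "k \<in> K") (simp_all add: add_ac mult_ac)
    then show ?thesis by simp
  qed
  ultimately show ?thesis by simp
qed

lemma nf_4r_of_B:
  assumes "nf m a B K \<in> C m" "B \<subseteq> {..<m}" "K \<subseteq> {..<m}" "k \<in> B" "k \<notin> K"
  shows "(\<lambda>x. 4 * prodx m x) \<in> C m"
  using nf_shift_one[OF assms(1-3), of k] assms by auto

lemma nf_falling_of_K:
  assumes "nf m a B K \<in> C m" "B \<subseteq> {..<m}" "K \<subseteq> {..<m}" "k \<in> K"
  shows "(\<lambda>x. 2 * prodx m x * (x k - 1)) \<in> C m"
proof -
  have "k < m" using assms by auto
  have "(\<lambda>x. if k \<in> B then 4 * prodx m x else 0) \<in> C m"
    using nf_4r_of_K[OF assms] const[OF arity_pos[OF assms(1)], of 0] by (cases "k \<in> B") simp_all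
  from diff[OF nf_shift_one[OF assms(1-3) \<open>k < m\<close>] this] show ?thesis
    using \<open>k \<in> K\<close> by simp
qed

text \<open>Index \<open>m\<close> is a fresh variable, and \<open>x k\<close> is replaced by
  \<open>x k + x m\<close>. Up to \<open>4 * prodx (Suc m) x\<close> the result is
  \<open>2 * v_op (Suc m)\<close> with the pair 0, 1 moved to \<open>k\<close>,
  \<open>m\<close>.\<close>

lemma nf_split:
  assumes "nf m a B K \<in> C m" "B \<subseteq> {..<m}" "K \<subseteq> {..<m}" "k \<in> K"
  shows "nf (Suc m) (if k \<in> B then 2 else 0) {k, m} {} \<in> C (Suc m)"
proof -
  have "k < m" using assms by auto
  have "(\<lambda>x. nf m a B K (x(k := x k + x m)) - nf m a B K (x(k := x k)) - nf m a B K (x(k := x m)))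
      \<in> C (Suc m)"
    using \<open>k < m\<close> by (intro diff subst_upd[OF assms(1)] add proj) auto
  moreover have "nf m a B K (x(k := x k + x m)) - nf m a B K (x(k := x k)) - nf m a B K (x(k := x m))
      = nf (Suc m) (if k \<in> B then 2 else 0) {k, m} {} x" for x
  proof -
    obtain p s where ps: "\<forall>y. prodx m (x(k := y)) = y * p \<and> nf m a B K (x(k := y)) =
        2 * (y * p) * (s + (if k \<in> B then y - 1 else 0) + (if k \<in> K then (y - 1) * y else 0))"
      using nf_upd[OF \<open>k < m\<close> assms(2,3), where x = x and a = a] by (elim exE)
    note p = ps[THEN spec, THEN conjunct1] and s = ps[THEN spec, THEN conjunct2]
    have P: "prodx (Suc m) x = x k * p * x m"
      using p[of "x k"] by (simp add: prodx_def)
    have "nf (Suc m) (if k \<in> B then 2 else 0) {k, m} {} x =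
        2 * (x k * p * x m) * (2 * (if k \<in> B then 1 else 0) + ((x k - 1) + (x m - 1)))"
      unfolding nf_def P using \<open>k < m\<close> by simp
    then show ?thesis
      unfolding s p using split_8[of "x k" "x m" p s "if k \<in> B then 1 else 0"] \<open>k \<in> K\<close>
      by (cases "k \<in> B") (simp_all only: if_True if_False mult_1 mult_zero_left add_0_right mult_zero_right)
  qed
  ultimately show ?thesis by simp
qed

lemma falling_transpose:
  assumes "(\<lambda>x. 2 * prodx m x * \<phi> (x k)) \<in> C m" "k < m" "l < m"
  shows "(\<lambda>x. 2 * prodx m x * \<phi> (x l)) \<in> C m"
  using subst_transpose[OF assms] by (simp add: prodx_transpose assms(2,3))

lemma pair_transpose:
  assumes "(\<lambda>x. 2 * prodx m x * (x i + x j)) \<in> C m" "i < m" "j < m" "l < m" "i \<noteq> j" "i \<noteq> l"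
  shows "(\<lambda>x. 2 * prodx m x * (x i + x l)) \<in> C m"
  using subst_transpose[OF assms(1,3,4)] assms(5,6) by (simp add: prodx_transpose assms(3,4))

text \<open>The product is symmetric, so a transposition moves one member of the pair; two moves
  reach any other pair.\<close>

lemma pair_any:
  assumes "(\<lambda>x. 2 * prodx m x * (x i + x j)) \<in> C m" "i < m" "j < m" "k < m" "l < m" "i \<noteq> j" "k \<noteq> l"
  shows "(\<lambda>x. 2 * prodx m x * (x k + x l)) \<in> C m"
proof -
  have sym: "(\<lambda>x. 2 * prodx m x * (x i + x j)) = (\<lambda>x. 2 * prodx m x * (x j + x i))" for i j
    by (simp add: add.commute)
  show ?thesis
  proof (cases "k = j")
    case True
    then show ?thesis using assms by (intro pair_transpose[of m k i l]) (auto simp: sym[of j i])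
  next
    case False
    have "(\<lambda>x. 2 * prodx m x * (x j + x k)) \<in> C m"
      using assms False by (intro pair_transpose[of m j i k]) (auto simp: sym[of j i])
    then have "(\<lambda>x. 2 * prodx m x * (x k + x j)) \<in> C m"
      by (simp only: sym[of k j])
    then show ?thesis using assms False by (intro pair_transpose[of m k j l]) auto
  qed
qed

end

section \<open>Normal form\<close>

text \<open>The second clause becomes additivity modulo 8 after doubling. The first clause is
  included to make the class closed under products.\<close>

definition mod4_affine :: "op8 \<Rightarrow> bool" where
  "mod4_affine \<psi> \<longleftrightarrow> (\<forall>c a b. 2 dvd \<psi> (\<lambda>i. c i + 2 * a i) - \<psi> c \<and>
    4 dvd \<psi> (\<lambda>i. c i + 2 * a i + 2 * b i) - \<psi> (\<lambda>i. c i + 2 * a i) - \<psi> (\<lambda>i. c i + 2 * b i) + \<psi> c)"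

lemma mod4_affine_const: "mod4_affine (\<lambda>x. k)"
  by (simp add: mod4_affine_def)

lemma mod4_affine_proj: "mod4_affine (\<lambda>x. x i)"
proof -
  have "x + 2 * y + 2 * z - (x + 2 * y) - (x + 2 * z) + x = 0" for x y z :: 8
    by (simp add: algebra_simps)
  then show ?thesis by (simp add: mod4_affine_def)
qed

lemma mod4_affine_add:
  assumes "mod4_affine \<phi>" "mod4_affine \<psi>"
  shows "mod4_affine (\<lambda>x. \<phi> x + \<psi> x)"
proof -
  have "(f + f') - (g + g') - (h + h') + (k + k') = (f - g - h + k) + (f' - g' - h' + k')"
    "(f + f') - (g + g') = (f - g) + (f' - g')"
    for f g h k f' g' h' k' :: 8
    by (simp_all add: algebra_simps)
  then show ?thesis using assms unfolding mod4_affine_def by (simp only: dvd_add simp_thms)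
qed

text \<open>Differences along even steps have the form \<open>2 * p\<close>, so every cross term of
  two of them is a multiple of 4.\<close>

lemma mod4_affine_mult:
  assumes "mod4_affine \<phi>" "mod4_affine \<psi>"
  shows "mod4_affine (\<lambda>x. \<phi> x * \<psi> x)"
  unfolding mod4_affine_def
proof (intro allI conjI)
  fix c a b :: "nat \<Rightarrow> 8"
  let ?ca = "\<lambda>i. c i + 2 * a i" and ?cb = "\<lambda>i. c i + 2 * b i"
    and ?cab = "\<lambda>i. c i + 2 * a i + 2 * b i"
  have *: "\<exists>p q r. \<chi> ?ca = \<chi> c + 2 * p \<and> \<chi> ?cb = \<chi> c + 2 * q \<and> \<chi> ?cab = \<chi> c + 2 * p + 2 * q + 4 * r"
    if "mod4_affine \<chi>" for \<chi>
  proof -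
    note D = that[unfolded mod4_affine_def, THEN spec, THEN spec, THEN spec]
    obtain p where "\<chi> ?ca - \<chi> c = 2 * p" by (rule dvdE[OF D[of c a b, THEN conjunct1]])
    moreover obtain q where "\<chi> ?cb - \<chi> c = 2 * q" by (rule dvdE[OF D[of c b a, THEN conjunct1]])
    moreover obtain r where "\<chi> ?cab - \<chi> ?ca - \<chi> ?cb + \<chi> c = 4 * r"
      by (rule dvdE[OF D[of c a b, THEN conjunct2]])
    ultimately show ?thesis by (intro exI[of _ p] exI[of _ q] exI[of _ r]) (simp add: algebra_simps)
  qed
  obtain p q r where 1: "\<phi> ?ca = \<phi> c + 2 * p" "\<phi> ?cb = \<phi> c + 2 * q"
      "\<phi> ?cab = \<phi> c + 2 * p + 2 * q + 4 * r"
    using *[OF assms(1)] by (elim exE conjE)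
  obtain p' q' r' where 2: "\<psi> ?ca = \<psi> c + 2 * p'" "\<psi> ?cb = \<psi> c + 2 * q'"
      "\<psi> ?cab = \<psi> c + 2 * p' + 2 * q' + 4 * r'"
    using *[OF assms(2)] by (elim exE conjE)
  have "\<phi> ?ca * \<psi> ?ca - \<phi> c * \<psi> c = 2 * (p * \<psi> c + \<phi> c * p' + 2 * p * p')"
    unfolding 1 2 by (simp add: algebra_simps)
  then show "2 dvd \<phi> ?ca * \<psi> ?ca - \<phi> c * \<psi> c"
    by (simp only: dvd_triv_left)
  have "\<phi> ?cab * \<psi> ?cab - \<phi> ?ca * \<psi> ?ca - \<phi> ?cb * \<psi> ?cb + \<phi> c * \<psi> c =
      4 * (r * \<psi> c + r' * \<phi> c + p * q' + q * p' + 2 * r * (p' + q') + 2 * r' * (p + q) + 4 * r * r')"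
    unfolding 1 2 by (simp add: algebra_simps)
  then show "4 dvd \<phi> ?cab * \<psi> ?cab - \<phi> ?ca * \<psi> ?ca - \<phi> ?cb * \<psi> ?cb + \<phi> c * \<psi> c"
    by (simp only: dvd_triv_left)
qed

lemma mod4_affine_sum: "(\<And>i. i \<in> A \<Longrightarrow> mod4_affine (\<phi> i)) \<Longrightarrow> mod4_affine (\<lambda>x. \<Sum>i\<in>A. \<phi> i x)"
  by (induction A rule: infinite_finite_induct) (simp_all add: mod4_affine_const mod4_affine_add)

lemma mod4_affine_prod: "(\<And>i. i \<in> A \<Longrightarrow> mod4_affine (\<phi> i)) \<Longrightarrow> mod4_affine (\<lambda>x. \<Prod>i\<in>A. \<phi> i x)"
  by (induction A rule: infinite_finite_induct) (simp_all add: mod4_affine_const mod4_affine_mult)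

lemma nf_additive:
  "nf m a0 B K (\<lambda>i. c i + 2 * a i + 2 * b i) =
    nf m a0 B K (\<lambda>i. c i + 2 * a i) + nf m a0 B K (\<lambda>i. c i + 2 * b i) - nf m a0 B K c"
proof -
  \<comment> \<open>Subtraction is written as adding \<open>- 1\<close>, which lets the closure
    rules for sums and constants apply directly.\<close>
  define \<psi> where "\<psi> x = prodx m x * (a0 + (\<Sum>i\<in>B. x i + (- 1)) + (\<Sum>i\<in>K. (x i + (- 1)) * x i))" for x
  have "mod4_affine \<psi>"
    unfolding \<psi>_def prodx_def
    by (intro mod4_affine_mult mod4_affine_add mod4_affine_sum mod4_affine_prod
        mod4_affine_const mod4_affine_proj)
  then have "4 dvd \<psi> (\<lambda>i. c i + 2 * a i + 2 * b i) - \<psi> (\<lambda>i. c i + 2 * a i) - \<psi> (\<lambda>i. c i + 2 * b i) + \<psi> c"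
    by (simp add: mod4_affine_def)
  then obtain k where
    k: "\<psi> (\<lambda>i. c i + 2 * a i + 2 * b i) - \<psi> (\<lambda>i. c i + 2 * a i) - \<psi> (\<lambda>i. c i + 2 * b i) + \<psi> c = 4 * k"
    by (rule dvdE)
  have nf: "nf m a0 B K x = 2 * \<psi> x" for x
    by (simp add: nf_def \<psi>_def mult.assoc)
  have "2 * \<psi> (\<lambda>i. c i + 2 * a i + 2 * b i) - 2 * \<psi> (\<lambda>i. c i + 2 * a i)
      - 2 * \<psi> (\<lambda>i. c i + 2 * b i) + 2 * \<psi> c = 2 * (4 * k)"
    unfolding k[symmetric] by (simp add: algebra_simps)
  also have "\<dots> = 0" by simp
  finally show ?thesis unfolding nf by (simp add: algebra_simps)
qed

text \<open>Write \<open>x\<close> as \<open>e + 2 * b\<close> with \<open>e\<close> having entries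
  0 and 1. Additivity in \<open>b\<close> reduces the claim to \<open>e\<close> and to single steps
  \<open>e + 2 * unit_vec i\<close>, and there either a coordinate is 0 or a prescribed value is
  met.\<close>

lemma vanishing_additive_eq_0:
  assumes ops: "E \<in> ops m"
    and additive: "\<And>c a b. E (\<lambda>i. c i + 2 * a i + 2 * b i) =
      E (\<lambda>i. c i + 2 * a i) + E (\<lambda>i. c i + 2 * b i) - E c"
    and van: "\<And>x i. i < m \<Longrightarrow> x i = 0 \<Longrightarrow> E x = 0"
    and E1: "E (\<lambda>_. 1) = 0"
    and E23: "\<And>i. i < m \<Longrightarrow> E ((\<lambda>_. 1)(i := 2)) = 0" "\<And>i. i < m \<Longrightarrow> E ((\<lambda>_. 1)(i := 3)) = 0"
  shows "E x = 0"
proof -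
  have "\<forall>i. \<exists>e b. e \<in> {0, 1} \<and> x i = e + 2 * of_nat b"
    by (metis parity_decomp_8)
  then obtain e b where e: "\<And>i. e i \<in> {0, 1}" and x: "\<And>i. x i = e i + 2 * of_nat (b i)"
    by metis
  have Ee: "E e = 0"
  proof (cases "\<exists>i<m. e i = 0")
    case True
    then show ?thesis using van by blast
  next
    case False
    then have "E e = E (\<lambda>_. 1)" using e by (intro opsD[OF ops]) auto
    then show ?thesis using E1 by simp
  qed
  have step: "E (\<lambda>j. e j + 2 * unit_vec i j) = 0" if i: "i < m" for i
  proof (cases "\<exists>j<m. j \<noteq> i \<and> e j = 0")
    case True
    then obtain j where "j < m" "j \<noteq> i" "e j = 0" by blast
    then show ?thesis by (intro van[of j]) (auto simp: unit_vec_def)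
  next
    case False
    \<comment> \<open>All other coordinates of \<open>e\<close> are 1, so only
      \<open>e i + 2\<close>, which is 2 or 3, differs from 1.\<close>
    then have "E (\<lambda>j. e j + 2 * unit_vec i j) = E ((\<lambda>_. 1)(i := e i + 2))"
      using e by (intro opsD[OF ops]) (auto simp: unit_vec_def)
    also have "\<dots> = 0" using e[of i] E23[OF i] by auto
    finally show ?thesis .
  qed
  have multi: "E (\<lambda>j. e j + 2 * (of_nat k * unit_vec i j)) = 0" if i: "i < m" for i k
  proof (induction k)
    case 0
    then show ?case using Ee by simp
  next
    case (Suc k)
    have "(\<lambda>j. e j + 2 * (of_nat (Suc k) * unit_vec i j)) =
        (\<lambda>j. e j + 2 * (of_nat k * unit_vec i j) + 2 * unit_vec i j)"
      by (simp add: algebra_simps)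
    then show ?case using additive Suc step[OF i] Ee by simp
  qed
  have part: "E (\<lambda>j. e j + 2 * (if j < l then of_nat (b j) else 0)) = 0" if "l \<le> m" for l
    using that
  proof (induction l)
    case 0
    then show ?case using Ee by simp
  next
    case (Suc l)
    have "(\<lambda>j. e j + 2 * (if j < Suc l then of_nat (b j) else 0)) =
        (\<lambda>j. e j + 2 * (if j < l then of_nat (b j) else 0) + 2 * (of_nat (b l) * unit_vec l j))"
      by (auto simp: fun_eq_iff unit_vec_def less_Suc_eq)
    then show ?case using additive Suc multi[of l "b l"] Ee by simp
  qed
  have "E x = E (\<lambda>j. e j + 2 * (if j < m then of_nat (b j) else 0))"
    using x by (intro opsD[OF ops]) simp
  then show ?thesis using part[of m] by simp
qed

lemma nf_ops:
  assumes "1 \<le> m" "B \<subseteq> {..<m}" "K \<subseteq> {..<m}"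
  shows "nf m a B K \<in> ops m"
  unfolding ops_def mem_Collect_eq
proof (intro conjI allI impI assms(1))
  fix x y :: "nat \<Rightarrow> 8"
  assume xy: "\<forall>i<m. x i = y i"
  have "prodx m x = prodx m y" unfolding prodx_def using xy by (intro prod.cong) auto
  moreover have "(\<Sum>i\<in>B. x i - 1) = (\<Sum>i\<in>B. y i - 1)"
    "(\<Sum>i\<in>K. (x i - 1) * x i) = (\<Sum>i\<in>K. (y i - 1) * y i)"
    using xy assms by (auto intro!: sum.cong simp: subset_iff)
  ultimately show "nf m a B K x = nf m a B K y" by (simp add: nf_def)
qed

lemma prodx_eq_0: "i < m \<Longrightarrow> x i = 0 \<Longrightarrow> prodx m x = 0"
  by (simp add: prodx_split)

text \<open>The data \<open>a\<close>, \<open>B\<close>, \<open>K\<close> are read off from the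
  values at the all-one point and at its changes to 2 and 3 in one coordinate. The difference from
  the resulting normal form then vanishes identically.\<close>

lemma ex_nf:
  assumes ops: "F \<in> ops m"
    and even: "\<And>x. 2 dvd F x"
    and mod4: "\<And>c a. 4 dvd F (\<lambda>i. c i + 2 * a i) - F c"
    and additive: "\<And>c a b. F (\<lambda>i. c i + 2 * a i + 2 * b i) =
      F (\<lambda>i. c i + 2 * a i) + F (\<lambda>i. c i + 2 * b i) - F c"
    and van: "\<And>x i. i < m \<Longrightarrow> x i = 0 \<Longrightarrow> F x = 0"
  obtains a B K where "B \<subseteq> {..<m}" "K \<subseteq> {..<m}" "F = nf m a B K"
proof -
  obtain a where a: "F (\<lambda>_. 1) = 2 * a" by (rule dvdE[OF even])
  let ?one = "\<lambda>i y. (\<lambda>_. 1 :: 8)(i := y)"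
  \<comment> \<open>At 2 the normal form takes the value \<open>4 * a\<close>, plus 4 for
    \<open>B\<close>. At 3 it is \<open>6 * a\<close>, plus 4 for each of \<open>B\<close> and
    \<open>K\<close>. The hypothesis modulo 4 leaves no other values.\<close>
  define B where "B = {i \<in> {..<m}. F (?one i 2) \<noteq> 4 * a}"
  define K where "K = {i \<in> {..<m}. F (?one i 3) \<noteq> 6 * a + (if i \<in> B then 4 else 0)}"
  have BK: "B \<subseteq> {..<m}" "K \<subseteq> {..<m}" by (auto simp: B_def K_def)
  have m: "1 \<le> m" using ops by (simp add: ops_def)
  have step: "4 dvd F (?one i (y + 2)) - F (?one i y)" for i y
  proof -
    have "(\<lambda>j. ?one i y j + 2 * unit_vec i j) = ?one i (y + 2)"
      by (auto simp: unit_vec_def)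
    then show ?thesis using mod4[of "?one i y" "unit_vec i"] by simp
  qed
  have four: "4 dvd 4 * z" for z :: 8 by simp
  have F2: "F (?one i 2) = 4 * a + (if i \<in> B then 4 else 0)" if i: "i < m" for i
  proof -
    have "4 dvd F (?one i 2)" using step[of i 0] van[OF i, of "?one i 0"] by simp
    moreover have "4 * a = 0 \<or> 4 * a = 4" using four_dvd_8[of "4 * a"] by simp
    ultimately show ?thesis using i by (cases "i \<in> B") (auto simp: B_def four_dvd_8)
  qed
  have F3: "F (?one i 3) = 6 * a + (if i \<in> B then 4 else 0) + (if i \<in> K then 4 else 0)"
    if i: "i < m" for i
  proof -
    have "4 dvd F (?one i 3) - 2 * a"
      using step[of i 1] a by (simp add: fun_upd_idem)
    then have "4 dvd (F (?one i 3) - 2 * a) - 4 * a - (if i \<in> B then 4 else 0)"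
      by (rule dvd_diff[OF dvd_diff[OF _ four]]) simp
    then have "4 dvd F (?one i 3) - (6 * a + (if i \<in> B then 4 else 0))"
      by (simp add: algebra_simps)
    then have "F (?one i 3) = 6 * a + (if i \<in> B then 4 else 0) \<or>
        F (?one i 3) = 6 * a + (if i \<in> B then 4 else 0) + 4"
      unfolding four_dvd_8 by (simp only: diff_eq_eq add_0_left add.commute)
    moreover have "i \<in> K \<longleftrightarrow> F (?one i 3) \<noteq> 6 * a + (if i \<in> B then 4 else 0)"
      using i by (simp add: K_def)
    ultimately show ?thesis by (cases "i \<in> K") (simp_all only: if_True if_False add_0_right simp_thms)
  qed
  define E where "E x = F x - nf m a B K x" for x
  have nf1: "nf m a B K (\<lambda>_. 1) = 2 * a" by (simp add: nf_def prodx_def)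
  have nfi: "nf m a B K (?one i y) =
      y * (2 * a) + 2 * y * ((if i \<in> B then y - 1 else 0) + (if i \<in> K then (y - 1) * y else 0))"
    if i: "i < m" for i y
  proof -
    obtain p s where ps: "\<forall>y. prodx m (?one i y) = y * p \<and> nf m a B K (?one i y) =
        2 * (y * p) * (s + (if i \<in> B then y - 1 else 0) + (if i \<in> K then (y - 1) * y else 0))"
      using nf_upd[OF i BK, where x = "\<lambda>_. 1" and a = a] by (elim exE)
    have "?one i 1 = (\<lambda>_. 1)" by auto
    then have "p = 1" using ps[THEN spec, of 1] by (simp add: prodx_def)
    moreover from this have "2 * s = 2 * a"
      using ps[THEN spec, of 1] nf1 \<open>?one i 1 = _\<close> by simp
    moreover have "nf m a B K (?one i y) = y * (2 * s) * p + 2 * (y * p) *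
        ((if i \<in> B then y - 1 else 0) + (if i \<in> K then (y - 1) * y else 0))"
      using ps[THEN spec, THEN conjunct2] by (simp only: algebra_simps)
    ultimately show ?thesis by simp
  qed
  have "E x = 0" for x
  proof (rule vanishing_additive_eq_0[where E = E and m = m and x = x])
    show "E \<in> ops m"
      unfolding ops_def mem_Collect_eq
    proof (intro conjI allI impI m)
      fix x y :: "nat \<Rightarrow> 8"
      assume xy: "\<forall>i<m. x i = y i"
      have "F x = F y" by (rule opsD[OF ops]) (use xy in blast)
      moreover have "nf m a B K x = nf m a B K y"
        by (rule opsD[OF nf_ops[OF m BK]]) (use xy in blast)
      ultimately show "E x = E y" by (simp add: E_def)
    qed
    show "E (\<lambda>i. c i + 2 * a i + 2 * b i) = E (\<lambda>i. c i + 2 * a i) + E (\<lambda>i. c i + 2 * b i) - E c"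
      for c a b
      unfolding E_def additive nf_additive by (simp add: algebra_simps)
    show "E x = 0" if "i < m" "x i = 0" for x i
      using van[of i x] prodx_eq_0[of i m x] that by (simp add: E_def nf_def)
    show "E (\<lambda>_. 1) = 0" using a nf1 by (simp add: E_def)
    show "E (?one i 2) = 0" if "i < m" for i
      using F2[OF that] nfi[OF that] by (simp add: E_def)
    show "E (?one i 3) = 0" if "i < m" for i
      using F3[OF that] nfi[OF that] by (simp add: E_def algebra_simps)
  qed
  then have "F = nf m a B K" by (auto simp: E_def fun_eq_iff)
  then show ?thesis using BK that by blast
qed

section \<open>Decomposition into special operations\<close>

lemma four_prodx_mult:
  assumes "i < m"
  shows "4 * prodx m x * x i = 4 * prodx m x"
proof -
  obtain p where p: "prodx m x = x i * p" using prodx_split[OF assms] by blast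
  have "4 * (x i * p) * x i = (4 * x i * x i) * p" by (simp only: mult_ac)
  then show ?thesis unfolding p four_idem_8 by (simp only: mult_ac)
qed

lemma four_prodx_falling: "i < m \<Longrightarrow> 4 * prodx m x * (x i - 1) = 0"
  by (simp add: right_diff_distrib four_prodx_mult)

text \<open>Identifying the last variable of a pair operation of arity \<open>m + 1\<close> with
  \<open>x i\<close> yields the first term; the correction needed to reach the summand from
  \<open>K\<close> vanishes by \<open>two_falling_8\<close> and
  \<open>four_prodx_falling\<close>.\<close>

lemma identify_pair_8:
  assumes "i < m" "j < m" "i \<noteq> j"
  shows "2 * prodx m x * x i * (x i + x j) - 2 * prodx m x * (x j - 1) - 4 * prodx m x
    = 2 * prodx m x * ((x i - 1) * x i)"
proof -
  define p where "p = (\<Prod>l\<in>{..<m}-{i}-{j}. x l)"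
  have P: "prodx m x = x i * (x j * p)"
    unfolding prodx_split[OF assms(1)] p_def using assms by (simp add: prod.remove[of "{..<m}-{i}" j])
  have "2 * prodx m x * x i * (x i + x j) - 2 * prodx m x * (x j - 1) - 4 * prodx m x
    = 2 * prodx m x * ((x i - 1) * x i) + 2 * (x i * x j) * ((x i - 1) * (x j - 1)) * p
      + 4 * prodx m x * (x i - 1)"
    unfolding P by (simp add: algebra_simps)
  then show ?thesis using assms(1) by (simp add: two_falling_8 four_prodx_falling)
qed

text \<open>The expressions for \<open>u_op\<close>, \<open>p_op\<close> and \<open>q_op\<close> use
  \<open>x 0 - 1\<close> and \<open>(x 0 - 1) * x 0\<close>, matching the summands of
  \<open>nf\<close>.\<close>

lemma scal_ops:
  "scal 4 r_op k = (\<lambda>x. 4 * prodx k x)"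
  "scal 2 r_op k = (\<lambda>x. 2 * prodx k x)"
  "scal 2 u_op k = (\<lambda>x. 2 * prodx k x * (x 0 - 1) + 4 * prodx k x)"
  "scal 2 v_op k = (\<lambda>x. 2 * prodx k x * (x 0 + x 1))"
  "scal 2 p_op k = (\<lambda>x. 2 * prodx k x * (x 0 - 1) + 2 * prodx k x)"
  "scal 2 q_op k = (\<lambda>x. 2 * prodx k x * ((x 0 - 1) * x 0) + 2 * prodx k x * (x 0 - 1) + 2 * prodx k x)"
  "scal 2 t_op k = (\<lambda>x. 2 * prodx k x * (sumx k x + (if even k then 0 else 1)))"
  "scal 2 s_op k = (\<lambda>x. 2 * prodx k x * (sumx k x + (if even k then 1 else 0)))"
  by (auto simp: fun_eq_iff scal_def r_op_def u_op_def v_op_def p_op_def q_op_def t_op_def s_op_def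
      algebra_simps)

text \<open>For even \<open>a\<close> the double is 0 or 4; for odd \<open>a\<close> the square is
  1.\<close>

lemma double_cases_8: "2 * a = 0 \<or> 2 * a = 4 \<or> a * (2 * a) = (2::8)"
proof -
  have "\<forall>a::8. 2 * a = 0 \<or> 2 * a = 4 \<or> a * (2 * a) = 2" unfolding forall_8 by simp
  then show ?thesis ..
qed

lemma double_parity_8: "2 * a \<in> {0, 4} \<or> 2 * (a - 1) \<in> {0, 4 :: 8}"
proof -
  have "\<forall>a::8. 2 * a \<in> {0, 4} \<or> 2 * (a - 1) \<in> {0, 4}" unfolding forall_8 by simp
  then show ?thesis ..
qed

text \<open>\<open>D\<close> is a subclone that shares all special operations with \<open>C\<close>.
  It is later the join of the joinands, and the aim is \<open>C = D\<close> when \<open>C\<close>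
  lies below \<open>M1\<close>.\<close>

locale special_reduct = C: pclone C + D: pclone D for C D :: opfam +
  assumes D_le_C: "D \<le> C"
    and t: "1 \<le> k \<Longrightarrow> scal 2 t_op k \<in> C k \<Longrightarrow> scal 2 t_op k \<in> D k"
    and u: "1 \<le> k \<Longrightarrow> scal 2 u_op k \<in> C k \<Longrightarrow> scal 2 u_op k \<in> D k"
    and v: "2 \<le> k \<Longrightarrow> scal 2 v_op k \<in> C k \<Longrightarrow> scal 2 v_op k \<in> D k"
    and s: "1 \<le> k \<Longrightarrow> scal 2 s_op k \<in> C k \<Longrightarrow> scal 2 s_op k \<in> D k"
    and p: "1 \<le> k \<Longrightarrow> scal 2 p_op k \<in> C k \<Longrightarrow> scal 2 p_op k \<in> D k"
    and q: "1 \<le> k \<Longrightarrow> scal 2 q_op k \<in> C k \<Longrightarrow> scal 2 q_op k \<in> D k"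
    and r: "1 \<le> k \<Longrightarrow> scal 2 r_op k \<in> C k \<Longrightarrow> scal 2 r_op k \<in> D k"
    and r4: "1 \<le> k \<Longrightarrow> scal 4 r_op k \<in> C k \<Longrightarrow> scal 4 r_op k \<in> D k"
begin

lemma DC: "f \<in> D n \<Longrightarrow> f \<in> C n"
  using D_le_C by (auto simp: le_fun_def)

text \<open>Peels off a part known to lie in \<open>D\<close>; the remainder still lies in
  \<open>C\<close>, so membership in \<open>C\<close> may be assumed when placing it in
  \<open>D\<close>.\<close>

lemma by_diff:
  assumes "f \<in> C n" "g \<in> D n" "(\<lambda>x. f x - g x) \<in> C n \<Longrightarrow> (\<lambda>x. f x - g x) \<in> D n"
  shows "f \<in> D n"
  using D.add[OF assms(3)[OF C.diff[OF assms(1) DC[OF assms(2)]]] assms(2)] by simp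

lemma four_prodx: "1 \<le> m \<Longrightarrow> (\<lambda>x. 4 * prodx m x) \<in> C m \<Longrightarrow> (\<lambda>x. 4 * prodx m x) \<in> D m"
  using r4 by (simp only: scal_ops)

lemma double_prodx:
  assumes "(\<lambda>x. 2 * a * prodx m x) \<in> C m"
  shows "(\<lambda>x. 2 * a * prodx m x) \<in> D m"
proof -
  have m: "1 \<le> m" by (rule C.arity_pos[OF assms])
  consider "2 * a = 0" | "2 * a = 4" | "a * (2 * a) = 2" using double_cases_8 by blast
  then show ?thesis
  proof cases
    case 1
    show ?thesis unfolding 1 using D.const[OF m, of 0] by simp
  next
    case 2
    show ?thesis using assms unfolding 2 by (rule four_prodx[OF m])
  next
    case 3
    \<comment> \<open>Multiplying by the odd \<open>a\<close> normalizes the coefficient to 2;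
      multiplying by \<open>a\<close> again restores it.\<close>
    have "(\<lambda>x. 2 * prodx m x) \<in> C m"
      using C.scale[OF assms, of a] 3 by (simp add: mult.assoc[symmetric])
    then have "(\<lambda>x. 2 * prodx m x) \<in> D m" using r[OF m] by (simp only: scal_ops)
    from D.scale[OF this, of a] show ?thesis by (simp add: mult_ac)
  qed
qed

lemma even_mult_prodx:
  assumes "(\<lambda>x. 4 * prodx m x) \<in> D m" "c \<in> {0, 4}"
  shows "(\<lambda>x. c * prodx m x) \<in> D m"
  using assms D.const[OF D.arity_pos[OF assms(1)], of 0] by auto

text \<open>Transposing \<open>k\<close> to 0 and adding \<open>4 * prodx m x\<close> gives
  \<open>2 * u_op m\<close>, which passes to \<open>D\<close>; the same moves are then undone inside
  \<open>D\<close>.\<close>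

lemma falling_of_C:
  assumes four: "(\<lambda>x. 4 * prodx m x) \<in> D m"
    and "(\<lambda>x. 2 * prodx m x * (x k - 1)) \<in> C m" "k < m" "i < m"
  shows "(\<lambda>x. 2 * prodx m x * (x i - 1)) \<in> D m"
proof -
  have "0 < m" using assms by simp
  have "(\<lambda>x. 2 * prodx m x * (x 0 - 1)) \<in> C m"
    using C.falling_transpose[of m "\<lambda>z. z - 1" k 0] assms \<open>0 < m\<close> by simp
  then have "scal 2 u_op m \<in> C m"
    unfolding scal_ops using DC[OF four] by (rule C.add)
  then have "scal 2 u_op m \<in> D m" using u \<open>0 < m\<close> by simp
  from D.diff[OF this four] have "(\<lambda>x. 2 * prodx m x * (x 0 - 1)) \<in> D m"
    by (simp add: scal_ops)
  then show ?thesis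
    using D.falling_transpose[of m "\<lambda>z. z - 1" 0 i] \<open>0 < m\<close> \<open>i < m\<close> by simp
qed

lemma pair_of_C:
  assumes "(\<lambda>x. 2 * prodx m x * (x i + x j)) \<in> C m" "i < m" "j < m" "i \<noteq> j" "k < m" "l < m" "k \<noteq> l"
  shows "(\<lambda>x. 2 * prodx m x * (x k + x l)) \<in> D m"
proof -
  have m: "0 < m" "1 < m" "2 \<le> m" using assms(2-4) by auto
  have "(\<lambda>x. 2 * prodx m x * (x 0 + x 1)) \<in> C m"
    by (rule C.pair_any[OF assms(1-3) m(1,2) assms(4)]) simp
  then have "(\<lambda>x. 2 * prodx m x * (x 0 + x 1)) \<in> D m"
    using v[OF m(3)] by (simp only: scal_ops)
  then show ?thesis
    by (rule D.pair_any) (use m assms in auto)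
qed

text \<open>For \<open>m = 1\<close> the remaining terms can be subtracted, which leads to
  \<open>q_op 1\<close>. For larger \<open>m\<close> the pair operation of arity
  \<open>m + 1\<close> produces the cubic term after two variables are identified.\<close>

lemma nf_K_term:
  assumes nf: "nf m a B K \<in> C m" "B \<subseteq> {..<m}" "K \<subseteq> {..<m}" and "k \<in> K" "i \<in> K"
    and four: "(\<lambda>x. 4 * prodx m x) \<in> D m"
    and falling: "\<And>i. i < m \<Longrightarrow> (\<lambda>x. 2 * prodx m x * (x i - 1)) \<in> D m"
  shows "(\<lambda>x. 2 * prodx m x * ((x i - 1) * x i)) \<in> D m"
proof -
  have m: "1 \<le> m" and lt: "k < m" "i < m" using assms by auto
  show ?thesis
  proof (cases "m = 1")
    case True
    have K: "K = {0}" and i: "i = 0" using \<open>i \<in> K\<close> \<open>K \<subseteq> {..<m}\<close> True by auto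
    have P: "prodx m x = x 0" for x by (simp add: prodx_def True)
    have "(\<lambda>x. \<Sum>i\<in>B. 2 * prodx m x * (x i - 1)) \<in> D m"
      using \<open>B \<subseteq> {..<m}\<close> by (intro D.sum[OF m] falling) auto
    \<comment> \<open>In arity 1 the product is a projection, so all its multiples are group
      polynomials.\<close>
    moreover have lin: "(\<lambda>x. c * prodx m x) \<in> D m" for c
      unfolding P using True by (intro D.scale D.proj) simp
    ultimately have "(\<lambda>x. (\<Sum>i\<in>B. 2 * prodx m x * (x i - 1)) + (2 * a) * prodx m x) \<in> D m"
      by (rule D.add)
    then have "(\<lambda>x. nf m a B K x - ((\<Sum>i\<in>B. 2 * prodx m x * (x i - 1)) + (2 * a) * prodx m x)) \<in> C m"
      by (intro C.diff nf(1) DC)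
    moreover have "nf m a B K x - ((\<Sum>i\<in>B. 2 * prodx m x * (x i - 1)) + (2 * a) * prodx m x) =
        2 * prodx m x * ((x 0 - 1) * x 0)" for x
      unfolding nf_def K sum_distrib_left[symmetric] by (simp add: distrib_left mult_ac)
    ultimately have "(\<lambda>x. 2 * prodx m x * ((x 0 - 1) * x 0)) \<in> C m" by simp
    moreover have "(\<lambda>x. 2 * prodx m x * (x 0 - 1)) \<in> D m"
      using m by (intro falling) simp
    ultimately have "scal 2 q_op m \<in> C m"
      unfolding scal_ops by (rule C.add[OF C.add[OF _ DC] DC[OF lin]])
    then have "scal 2 q_op m \<in> D m" by (rule q[OF m])
    from D.diff[OF D.diff[OF this lin[of 2]] falling[of 0]] show ?thesis
      using lt i by (simp add: scal_ops)
  next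
    case False
    then obtain j where j: "j < m" "j \<noteq> i"
      using m lt by (intro that[of "if i = 0 then 1 else 0"]) auto
    have split: "nf (Suc m) (if k \<in> B then 2 else 0) {k, m} {} \<in> C (Suc m)"
      using nf \<open>k \<in> K\<close> by (rule C.nf_split)
    have four': "(\<lambda>x. 4 * prodx (Suc m) x) \<in> C (Suc m)"
      by (rule C.nf_4r_of_B[OF split, of k]) (use lt in auto)
    \<comment> \<open>For \<open>k\<close> in \<open>B\<close> the constants already cancel;
      otherwise \<open>4 * prodx (Suc m) x\<close> cancels the remaining \<open>- 2\<close>.\<close>
    have "(\<lambda>x. (if k \<in> B then 0 else 4) * prodx (Suc m) x) \<in> C (Suc m)"
      using four' C.const[of "Suc m" 0] by (cases "k \<in> B") simp_all
    from C.add[OF split this] have "(\<lambda>x. 2 * prodx (Suc m) x * (x k + x m)) \<in> C (Suc m)"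
      using lt by (cases "k \<in> B") (simp_all add: nf_def algebra_simps)
    then have pair: "(\<lambda>x. 2 * prodx (Suc m) x * (x i + x j)) \<in> D (Suc m)"
      by (rule pair_of_C) (use lt j in auto)
    have "(\<lambda>x. 2 * prodx (Suc m) (x(m := x i)) * ((x(m := x i)) i + (x(m := x i)) j)) \<in> D m"
    proof (rule D.comp[OF pair])
      show "(\<lambda>x. (x(m := x i)) l) \<in> D m" if "l < Suc m" for l
        using that lt by (cases "l = m") auto
    qed
    moreover have "prodx (Suc m) (x(m := x i)) = prodx m x * x i" for x
      by (simp add: prodx_def)
    ultimately have "(\<lambda>x. 2 * prodx m x * x i * (x i + x j)) \<in> D m"
      using lt j by (simp add: mult.assoc)
    from D.diff[OF D.diff[OF this falling[OF j(1)]] four] show ?thesis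
      using identify_pair_8[OF lt(2) j(1)] j(2) by simp
  qed
qed

text \<open>Nonempty \<open>K\<close> makes every summand available separately. For empty
  \<open>K\<close>, the case \<open>B\<close> empty leads to \<open>r_op\<close>, all of
  \<open>{..<m}\<close> to \<open>t_op\<close> or \<open>s_op\<close>, and a proper nonempty
  \<open>B\<close> to \<open>v_op\<close> together with \<open>u_op\<close>, \<open>p_op\<close> or
  \<open>r_op\<close>.\<close>

lemma nf_in_D:
  assumes nf: "nf m a B K \<in> C m" "B \<subseteq> {..<m}" "K \<subseteq> {..<m}"
  shows "nf m a B K \<in> D m"
proof -
  have m: "1 \<le> m" by (rule C.arity_pos[OF nf(1)])
  have [simp]: "finite B" "finite K" using nf(2,3) finite_subset by blast+
  show ?thesis
  proof (cases "K = {}")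
    case False
    then obtain k where k: "k \<in> K" by blast
    have four: "(\<lambda>x. 4 * prodx m x) \<in> D m"
      by (rule four_prodx[OF m C.nf_4r_of_K[OF nf k]])
    have falling: "(\<lambda>x. 2 * prodx m x * (x i - 1)) \<in> D m" if "i < m" for i
      using k nf(3) that by (intro falling_of_C[OF four C.nf_falling_of_K[OF nf k]]) auto
    let ?g = "\<lambda>x. (\<Sum>i\<in>B. 2 * prodx m x * (x i - 1)) + (\<Sum>i\<in>K. 2 * prodx m x * ((x i - 1) * x i))"
    have g: "?g \<in> D m"
      using nf(2) by (intro D.add D.sum[OF m] falling nf_K_term[OF nf k _ four falling]) auto
    have eq: "nf m a B K x - ?g x = 2 * a * prodx m x" for x
      unfolding nf_def sum_distrib_left[symmetric] by (simp add: distrib_left mult_ac)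
    show ?thesis
      by (rule by_diff[OF nf(1) g]) (unfold eq, rule double_prodx)
  next
    case K: True
    show ?thesis
    proof (cases "B = {}")
      case True
      have eq: "nf m a B K = (\<lambda>x. 2 * a * prodx m x)"
        by (simp add: nf_def K True mult_ac)
      show ?thesis using nf(1) unfolding eq by (rule double_prodx)
    next
      case False
      then obtain k where k: "k \<in> B" by blast
      have four: "(\<lambda>x. 4 * prodx m x) \<in> D m"
        by (rule four_prodx[OF m C.nf_4r_of_B[OF nf k]]) (simp add: K)
      show ?thesis
      proof (cases "B = {..<m}")
        case True
        have sum: "(\<lambda>x. 2 * prodx m x * (sumx m x + e)) \<in> D m"
          if "(\<lambda>x. 2 * prodx m x * (sumx m x + e)) \<in> C m" "e \<in> {0, 1}" for e
        \<comment> \<open>The parity of \<open>m\<close> decides which of the two shifted sums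
          belongs to \<open>t_op\<close> and which to \<open>s_op\<close>.\<close>
        proof (cases "e = (if even m then 0 else 1)")
          case True
          then show ?thesis using that(1) t[OF m] by (simp only: scal_ops)
        next
          case False
          then have "e = (if even m then 1 else 0)" using that(2) by (auto split: if_splits)
          then show ?thesis using that(1) s[OF m] by (simp only: scal_ops)
        qed
        define c where "c = a - of_nat m"
        have eq: "nf m a B K x = 2 * prodx m x * (sumx m x + e) + 2 * (c - e) * prodx m x" for x e
          by (simp add: nf_def K True sumx_def sum_subtractf c_def algebra_simps)
        \<comment> \<open>Taking \<open>e\<close> with the parity of \<open>c\<close> leaves a
          multiple of the product that \<open>4 * prodx m x\<close> already covers.\<close>
        have "\<exists>e\<in>{0, 1}. 2 * (c - e) \<in> {0, 4}"
          using double_parity_8[of c] by simp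
        then obtain e where e: "e \<in> {0, 1}" "2 * (c - e) \<in> {0, 4}" by (elim bexE)
        have D: "(\<lambda>x. 2 * (c - e) * prodx m x) \<in> D m"
          by (rule even_mult_prodx[OF four e(2)])
        show ?thesis
          by (rule by_diff[OF nf(1) D]) (unfold eq[of _ e] add_diff_cancel_right', rule sum[OF _ e(1)])
      next
        case False
        then obtain j where j: "j < m" "j \<notin> B" using nf(2) by auto
        have km: "k < m" and kj: "k \<noteq> j" using k j nf(2) by auto
        \<comment> \<open>Swapping \<open>k\<close> in \<open>B\<close> with \<open>j\<close>
          outside isolates \<open>x k - x j\<close>; adding \<open>4 * prodx m x\<close>, which
          equals \<open>4 * prodx m x * x j\<close>, turns the minus sign into plus.\<close>
        have "(\<lambda>x. nf m a B K x - nf m a B K (\<lambda>i. x (transpose k j i)) + 4 * prodx m x) \<in> C m"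
          using km j by (intro C.add C.diff nf(1) C.subst_transpose DC[OF four]) auto
        moreover have "nf m a B K x - nf m a B K (\<lambda>i. x (transpose k j i)) + 4 * prodx m x =
            2 * prodx m x * (x k + x j)" for x
        proof -
          have "(\<Sum>i\<in>B-{k}. x (transpose k j i) - 1) = (\<Sum>i\<in>B-{k}. x i - 1)"
            using j by (intro sum.cong refl) (auto simp: transpose_def)
          then have sj: "(\<Sum>i\<in>B. x (transpose k j i) - 1) = x j - 1 + (\<Sum>i\<in>B-{k}. x i - 1)"
            using k by (simp add: sum.remove)
          have sk: "(\<Sum>i\<in>B. x i - 1) = x k - 1 + (\<Sum>i\<in>B-{k}. x i - 1)"
            using k by (simp add: sum.remove)
          have "nf m a B K x - nf m a B K (\<lambda>i. x (transpose k j i)) + 4 * prodx m x =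
              2 * prodx m x * (x k - x j) + 4 * prodx m x"
            unfolding nf_def K prodx_transpose[OF km j(1)] sj sk by (simp add: algebra_simps)
          also have "\<dots> = 2 * prodx m x * (x k - x j) + 4 * prodx m x * x j"
            by (simp only: four_prodx_mult[OF j(1)])
          also have "\<dots> = 2 * prodx m x * (x k + x j)"
            by (simp add: algebra_simps)
          finally show ?thesis .
        qed
        ultimately have pair: "(\<lambda>x. 2 * prodx m x * (x k + x j)) \<in> C m" by simp
        have m0: "0 < m" using m by simp
        have double: "(\<lambda>x. 2 * prodx m x * ((x i - 1) + (x 0 - 1))) \<in> D m" if "i < m" for i
        proof (cases "i = 0")
          case True
          have "2 * prodx m x * ((x i - 1) + (x 0 - 1)) = 4 * prodx m x * (x 0 - 1)" for x
            unfolding True by (simp add: algebra_simps)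
          then show ?thesis using D.const[OF m, of 0] m0 by (simp add: four_prodx_falling)
        next
          case False
          have "(\<lambda>x. 2 * prodx m x * (x i + x 0)) \<in> D m"
            using pair km j(1) kj that m0 False by (rule pair_of_C)
          from D.diff[OF this four] show ?thesis by (simp add: algebra_simps)
        qed
        \<comment> \<open>Twice \<open>?h\<close> is 0, so only the parity of the number of copies
          of \<open>x 0 - 1\<close> matters.\<close>
        define c :: 8 where "c = (if even (card B) then 0 else 1)"
        let ?h = "\<lambda>x. 2 * prodx m x * (x 0 - 1)"
        have card: "of_nat (card B) * ?h x = c * ?h x" for x
        proof -
          have "of_nat (2 * l) * ?h x = 0" for l
          proof -
            have "of_nat (2 * l) * ?h x = of_nat l * (4 * prodx m x * (x 0 - 1))"
              by (simp add: algebra_simps)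
            then show ?thesis using m0 by (simp add: four_prodx_falling)
          qed
          then show ?thesis
            by (cases "even (card B)") (auto simp: c_def elim!: evenE oddE simp: distrib_right)
        qed
        let ?g = "\<lambda>x. \<Sum>i\<in>B. 2 * prodx m x * ((x i - 1) + (x 0 - 1))"
        have g: "?g \<in> D m" using nf(2) by (intro D.sum[OF m] double) auto
        have eq: "nf m a B K x - ?g x = 2 * a * prodx m x - c * ?h x" for x
          unfolding nf_def K sum_distrib_left[symmetric] sum.distrib card[symmetric]
          by (simp add: algebra_simps)
        show ?thesis
        proof (rule by_diff[OF nf(1) g], unfold eq)
          assume C: "(\<lambda>x. 2 * a * prodx m x - c * ?h x) \<in> C m"
          show "(\<lambda>x. 2 * a * prodx m x - c * ?h x) \<in> D m"
          \<comment> \<open>The remainder is a multiple of the product if \<open>card B\<close> is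
            even. If it is odd, then up to a multiple of \<open>4 * prodx m x\<close> it comes from
            \<open>u_op\<close> for even \<open>a\<close> and from \<open>p_op\<close> for odd
            \<open>a\<close>.\<close>
          proof (cases "even (card B)")
            case True
            then show ?thesis using double_prodx[of a m] C by (simp add: c_def)
          next
            case False
            then have c: "c = 1" by (simp add: c_def)
            from double_parity_8[of a] show ?thesis
            proof
              assume "2 * a \<in> {0, 4}"
              then have a: "(\<lambda>x. 2 * a * prodx m x) \<in> D m"
                by (rule even_mult_prodx[OF four])
              have "?h \<in> C m" using C.diff[OF DC[OF a] C] by (simp add: c)
              then have "?h \<in> D m" using falling_of_C[OF four] m0 by blast
              from D.diff[OF a this] show ?thesis by (simp add: c)
            next
              assume "2 * (a - 1) \<in> {0, 4}"
              then have a: "(\<lambda>x. 2 * (a - 1) * prodx m x) \<in> D m"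
                by (rule even_mult_prodx[OF four])
              have neg: "- ?h x = ?h x" for x
                using four_prodx_falling[OF m0, of x] by (simp add: algebra_simps)
              have pop: "2 * a * prodx m x - c * ?h x = 2 * (a - 1) * prodx m x + scal 2 p_op m x" for x
                unfolding scal_ops c using neg[of x] by (simp add: algebra_simps)
              have "scal 2 p_op m \<in> C m"
                using C.diff[OF C DC[OF a]] unfolding pop by simp
              from D.add[OF a p[OF m this]] show ?thesis unfolding pop .
            qed
          qed
        qed
      qed
    qed
  qed
qed

end

section \<open>Reduction of arbitrary operations to normal forms\<close>

context special_reduct begin

text \<open>Outer induction on the arity, inner induction on the number \<open>d\<close> of
  coordinates at which vanishing is not yet known. Setting \<open>x k\<close> to 0 leaves an
  operation of smaller essential arity, and subtracting it adds \<open>k\<close> to the coordinates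
  at which \<open>G\<close> vanishes.\<close>

lemma even_in_D:
  assumes M1: "C \<le> M1" and "F \<in> C n" "\<And>x. 2 dvd F x"
  shows "F \<in> D n"
  using assms(2,3)
proof (induction n arbitrary: F)
  case 0
  then show ?case using C.arity_pos by fastforce
next
  case (Suc n)
  note arity_IH = Suc.IH
  have "G \<in> D (Suc n)"
    if "G \<in> C (Suc n)" "\<And>x. 2 dvd G x" "\<And>x i. i < k \<Longrightarrow> x i = 0 \<Longrightarrow> G x = 0" "k + d = Suc n" for G k d
    using that
  proof (induction d arbitrary: G k)
    case 0
    note G = "0.prems"
    have Z: "preserves_Z (Suc n) G" using G(1) M1 by (auto simp: le_fun_def M1_def)
    have mod4: "4 dvd G (\<lambda>i. c i + 2 * a i) - G c" for c a
    proof -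
      \<comment> \<open>Evenness of \<open>G\<close> makes the doubled difference in (Z1) vanish
        modulo 4.\<close>
      have "4 dvd 2 * (G (\<lambda>i. c i + a i) - G c)"
        using G(2) by (intro four_mult_even_8 dvd_diff)
      from dvd_add[OF preserves_Z_differences(1)[OF Z, of c a] this] show ?thesis by simp
    qed
    have van: "G x = 0" if "i < Suc n" "x i = 0" for x i
      using G(3)[of i x] that G(4) by simp
    obtain a B K where "B \<subseteq> {..<Suc n}" "K \<subseteq> {..<Suc n}" "G = nf (Suc n) a B K"
      by (rule ex_nf[OF C.in_ops[OF G(1)] G(2) mod4 preserves_Z_differences(3)[OF Z] van])
    then show ?case using nf_in_D G(1) by simp
  next
    case (Suc d)
    note G = Suc.prems
    have k: "k < Suc n" using G(4) by simp
    let ?G0 = "\<lambda>x. G (x(k := 0))"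
    have G0C: "?G0 \<in> C (Suc n)"
      by (intro C.subst_upd[OF G(1)] C.const) simp_all
    have "(\<lambda>x. G x - ?G0 x) \<in> D (Suc n)"
    proof (rule Suc.IH[of _ "Suc k"])
      show "(\<lambda>x. G x - ?G0 x) \<in> C (Suc n)" by (rule C.diff[OF G(1) G0C])
      show "2 dvd G x - ?G0 x" for x using G(2) by (rule dvd_diff) (rule G(2))
      show "G x - ?G0 x = 0" if "i < Suc k" "x i = 0" for x i
      proof (cases "i = k")
        case True
        then have "x(k := 0) = x" using that(2) by auto
        then show ?thesis by simp
      next
        case False
        then have "i < k" "(x(k := 0)) i = 0" using that by simp_all
        then have "G (x(k := 0)) = 0" by (rule G(3))
        moreover have "G x = 0" using \<open>i < k\<close> that(2) by (rule G(3))
        ultimately show ?thesis by (simp only: diff_self)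
      qed
    qed (use G(4) in simp)
    moreover have "?G0 \<in> D (Suc n)"
    proof (cases "n = 0")
      case True
      then have "?G0 = (\<lambda>x. G (\<lambda>_. 0))"
        using k by (intro ext opsD[OF C.in_ops[OF G(1)]]) simp
      then show ?thesis using D.const by simp
    next
      case False
      \<comment> \<open>Slot \<open>k\<close> holds the constant 0, so position \<open>k\<close> of
        the shorter argument list is free to carry the last variable; substituting
        \<open>x n\<close> for \<open>x k\<close> afterwards restores \<open>?G0\<close>. This also
        covers \<open>k = n\<close>.\<close>
      let ?g = "\<lambda>y i. if i = k then 0 else if i = n then y k else y i :: 8"
      have "(\<lambda>y. G (?g y)) \<in> C n"
      proof (rule C.comp[OF G(1)])
        show "(\<lambda>y. ?g y i) \<in> C n" if "i < Suc n" for i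
          using that k False C.const[of n 0] by (cases "i = k"; cases "i = n") auto
      qed
      then have "(\<lambda>y. G (?g y)) \<in> D n" using G(2) by (rule arity_IH)
      then have "(\<lambda>x. G (?g (x(k := x n)))) \<in> D (Suc n)"
        by (intro D.subst_upd[of _ n "Suc n"]) auto
      moreover have "?g (x(k := x n)) = x(k := 0)" for x :: "nat \<Rightarrow> 8" by auto
      ultimately show ?thesis by simp
    qed
    ultimately have "(\<lambda>x. (G x - ?G0 x) + ?G0 x) \<in> D (Suc n)" by (rule D.add)
    then show ?case by simp
  qed
  from this[of F 0 "Suc n"] show ?case using Suc.prems by simp
qed

text \<open>The affine function from \<open>affine_mod_2\<close> is a group polynomial and lies in
  \<open>D\<close>; what remains is even-valued.\<close>

lemma eq_of_le_M1:
  assumes M1: "C \<le> M1"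
  shows "C = D"
proof (rule antisym[OF _ D_le_C], rule le_funI, rule subsetI)
  fix n f assume f: "f \<in> C n"
  have n: "1 \<le> n" by (rule C.arity_pos[OF f])
  have "preserves_Z n f" using f M1 by (auto simp: le_fun_def M1_def)
  from preserves_Z_differences(2)[OF this, of "\<lambda>_. 0"]
  have "2 dvd f (\<lambda>i. a i + b i) - f a - f b + f (\<lambda>_. 0)" for a b by simp
  then obtain k m where km: "\<And>x. 2 dvd f x - (k + (\<Sum>i<n. m i * x i))"
    using affine_mod_2[OF C.in_ops[OF f]] by metis
  have D: "(\<lambda>x. k + (\<Sum>i<n. m i * x i)) \<in> D n"
    by (intro D.add D.const D.sum D.scale D.proj n) simp
  show "f \<in> D n"
    by (rule by_diff[OF f D]) (rule even_in_D[OF M1 _ km])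
qed

end

section \<open>Joinands\<close>

text \<open>Negation is multiplication by 7, a sum of seven copies. It bridges \<open>Cgen\<close>,
  generated by addition and constants, and \<open>P_add\<close>, whose generators include
  negation.\<close>

lemma neg_op_in_clone:
  assumes "is_clone D" "add_op \<in> D 2"
  shows "neg_op \<in> D 1"
proof -
  have x: "(\<lambda>x. x 0) \<in> D 1" using assms(1) by (simp add: is_clone_def)
  have mult: "(\<lambda>x. of_nat (Suc j) * x 0) \<in> D 1" for j
  proof (induction j)
    case 0
    then show ?case using x by simp
  next
    case (Suc j)
    have "(\<lambda>x. add_op (\<lambda>i. if i = 0 then x 0 else of_nat (Suc j) * x 0)) \<in> D 1"
    proof (rule is_clone_comp[OF assms])
      show "(\<lambda>x. if i = 0 then x 0 else of_nat (Suc j) * x 0) \<in> D 1" for i :: nat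
        using x Suc by (cases "i = 0") simp_all
    qed
    then show ?case by (simp add: add_op_def distrib_right)
  qed
  have "\<forall>y::8. of_nat (Suc 6) * y = - y" unfolding forall_8 by simp
  then have "neg_op = (\<lambda>x. of_nat (Suc 6) * x 0)" by (simp only: neg_op_def simp_thms)
  then show ?thesis using mult[of 6] by (simp only:)
qed

lemma (in pclone) single_op_le: "f \<in> C k \<Longrightarrow> single_op k f \<le> C"
  by (auto simp: single_op_def le_fun_def)

lemma (in pclone) constants_le: "constants \<le> C"
  using generators(3) by (auto simp: constants_def le_fun_def)

lemma (in pclone)
  assumes "f \<in> C k"
  shows Cgen_le: "Cgen k f \<le> C"
    and pclone_Cgen: "pclone (Cgen k f)"
    and in_Cgen: "f \<in> Cgen k f k"
proof -
  let ?F = "sup (sup (single_op k f) (single_op 2 add_op)) constants"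
  have F: "?F \<le> C"
    using assms generators(1) by (intro sup_least single_op_le constants_le)
  show "Cgen k f \<le> C" unfolding Cgen_def by (rule clone_gen_least[OF is_clone F])
  have "?F \<le> Cgen k f" unfolding Cgen_def by (rule clone_gen_upper)
  then have le: "single_op k f \<le> Cgen k f" "single_op 2 add_op \<le> Cgen k f" "constants \<le> Cgen k f"
    by simp_all
  show "f \<in> Cgen k f k" using le_funD[OF le(1), of k] by (simp add: single_op_def)
  have add: "add_op \<in> Cgen k f 2" using le_funD[OF le(2), of 2] by (simp add: single_op_def)
  show "pclone (Cgen k f)"
  proof
    show clone: "is_clone (Cgen k f)" unfolding Cgen_def by (rule is_clone_clone_gen[OF is_clone F])
    have "single_op 1 neg_op \<le> Cgen k f"
      using neg_op_in_clone[OF clone add] by (auto simp: single_op_def le_fun_def)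
    then show "P_add \<le> Cgen k f"
      unfolding P_add_def using le by (intro clone_gen_least clone sup_least)
  qed
qed

text \<open>The interface between a choice of parameter and \<open>special_reduct\<close>: the final
  step works with a joinand through these properties only.\<close>

definition covers :: "opfam \<Rightarrow> nat \<Rightarrow> (nat \<Rightarrow> op8) \<Rightarrow> opfam \<Rightarrow> bool" where
  "covers C lo f J \<longleftrightarrow> J \<le> C \<and> P_add \<le> J \<and> (\<forall>k\<ge>lo. f k \<in> C k \<longrightarrow> f k \<in> J k)"

text \<open>The set of arities in \<open>C\<close> is closed downward from any member to
  \<open>lo\<close>. It is empty, has a maximum or is infinite, giving the parameter 0, the maximum
  or infinity. Closure is assumed for every \<open>E\<close>, as it is also applied inside the clone
  generated by the operation of maximal arity.\<close>

lemma ex_joinand: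
  assumes "pclone C" "1 \<le> lo"
    and down: "\<And>E k. pclone E \<Longrightarrow> lo \<le> k \<Longrightarrow> f (Suc k) \<in> E (Suc k) \<Longrightarrow> f k \<in> E k"
  shows "\<exists>N. covers C lo f (joinand lo f N)"
proof -
  interpret pclone C by fact
  have downs: "f k \<in> E k" if "pclone E" "f j \<in> E j" "lo \<le> k" "k \<le> j" for E j k
    using that(4,2)
  proof (induction rule: inc_induct)
    case (step n)
    then show ?case using down[OF that(1), of n] that(3) by simp
  qed
  define S where "S = {k. lo \<le> k \<and> f k \<in> C k}"
  consider "S = {}" | "finite S" "S \<noteq> {}" | "infinite S" by blast
  then show ?thesis
  proof cases
    case 1
    have "joinand lo f 0 = P_add"
      using assms(2) by (simp add: joinand_def zero_enat_def)
    then show ?thesis using 1 P_add_le by (intro exI[of _ 0]) (auto simp: S_def covers_def)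
  next
    case 2
    let ?N = "Max S"
    have N: "lo \<le> ?N" "f ?N \<in> C ?N" using Max_in[OF 2] by (auto simp: S_def)
    have J: "joinand lo f (enat ?N) = Cgen ?N (f ?N)"
      using N(1) by (simp add: joinand_def)
    have "f k \<in> Cgen ?N (f ?N) k" if "lo \<le> k" "f k \<in> C k" for k
    proof (rule downs[OF pclone_Cgen[OF N(2)] in_Cgen[OF N(2)] that(1)])
      show "k \<le> ?N" using that 2 by (intro Max_ge) (auto simp: S_def)
    qed
    moreover have "P_add \<le> Cgen ?N (f ?N)"
      using pclone_Cgen[OF N(2)] by (rule pclone.P_add_le)
    ultimately show ?thesis
      using Cgen_le[OF N(2)] by (intro exI[of _ "enat ?N"]) (simp add: J covers_def)
  next
    case 3
    have f: "f k \<in> C k" if "lo \<le> k" for k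
    proof -
      obtain j where "k \<le> j" "j \<in> S" using 3 infinite_nat_iff_unbounded_le by blast
      then show ?thesis using downs[OF assms(1), of j k] that by (simp add: S_def)
    qed
    let ?X = "{Cgen k (f k) | k. lo \<le> k}"
    have J: "joinand lo f \<infinity> = clone_gen (Sup ?X)" by (simp add: joinand_def clone_Join_def)
    have "Sup ?X \<le> C" using Cgen_le[OF f] by (intro Sup_least) blast
    then have "clone_gen (Sup ?X) \<le> C" by (rule clone_gen_least[OF is_clone])
    moreover have up: "Cgen k (f k) \<le> clone_gen (Sup ?X)" if "lo \<le> k" for k
      by (rule order_trans[OF Sup_upper clone_gen_upper]) (use that in blast)
    moreover have "P_add \<le> clone_gen (Sup ?X)"
      using pclone.P_add_le[OF pclone_Cgen[OF f[OF order_refl]]] up[OF order_refl] by (rule order_trans)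
    moreover have "f k \<in> clone_gen (Sup ?X) k" if "lo \<le> k" for k
      using in_Cgen[OF f[OF that]] le_funD[OF up[OF that]] by blast
    ultimately show ?thesis unfolding J[symmetric] covers_def by blast
  qed
qed

lemma prodx_Suc_upd: "prodx (Suc k) (x(k := c)) = prodx k x * c"
  and sumx_Suc_upd: "sumx (Suc k) (x(k := c)) = sumx k x + c"
  by (simp_all add: prodx_def sumx_def)

section \<open>Downward closure of the arities of each family\<close>

context pclone begin

lemma subst_const_last:
  assumes "g \<in> C (Suc k)" "1 \<le> k"
  shows "(\<lambda>x. g (x(k := c))) \<in> C k"
proof (rule comp[OF assms(1)])
  show "(\<lambda>x. (x(k := c)) i) \<in> C k" if "i < Suc k" for i
    using that const[OF assms(2)] by (cases "i = k") auto
qed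

text \<open>The last variable is set to 1. For \<open>v_op\<close> the bound
  \<open>2 \<le> k\<close> keeps it apart from \<open>x 0\<close> and \<open>x 1\<close>.\<close>

lemma special_downward:
  assumes "1 \<le> k"
  shows "scal c r_op (Suc k) \<in> C (Suc k) \<Longrightarrow> scal c r_op k \<in> C k"
    and "scal c u_op (Suc k) \<in> C (Suc k) \<Longrightarrow> scal c u_op k \<in> C k"
    and "scal c p_op (Suc k) \<in> C (Suc k) \<Longrightarrow> scal c p_op k \<in> C k"
    and "scal c q_op (Suc k) \<in> C (Suc k) \<Longrightarrow> scal c q_op k \<in> C k"
    and "2 \<le> k \<Longrightarrow> scal c v_op (Suc k) \<in> C (Suc k) \<Longrightarrow> scal c v_op k \<in> C k"
  using subst_const_last[OF _ assms, of "scal c r_op (Suc k)" 1]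
    subst_const_last[OF _ assms, of "scal c u_op (Suc k)" 1]
    subst_const_last[OF _ assms, of "scal c p_op (Suc k)" 1]
    subst_const_last[OF _ assms, of "scal c q_op (Suc k)" 1]
    subst_const_last[OF _ assms, of "scal c v_op (Suc k)" 1] assms
  by (simp_all add: scal_def r_op_def u_op_def p_op_def q_op_def v_op_def prodx_Suc_upd)

text \<open>The added constant alternates with the arity. If it must appear, the last variable is
  set to 1; if it must disappear, it is set to -1 and the sign of the product is corrected by
  negation.\<close>

lemma special_downward_sum:
  assumes "1 \<le> k"
  shows "scal c t_op (Suc k) \<in> C (Suc k) \<Longrightarrow> scal c t_op k \<in> C k"
    and "scal c s_op (Suc k) \<in> C (Suc k) \<Longrightarrow> scal c s_op k \<in> C k"
proof -
  assume t: "scal c t_op (Suc k) \<in> C (Suc k)"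
  show "scal c t_op k \<in> C k"
  proof (cases "even k")
    case True
    then show ?thesis using neg[OF subst_const_last[OF t assms, of "-1"]]
      by (simp add: scal_def t_op_def prodx_Suc_upd sumx_Suc_upd)
  next
    case False
    then show ?thesis using subst_const_last[OF t assms, of 1]
      by (simp add: scal_def t_op_def prodx_Suc_upd sumx_Suc_upd)
  qed
next
  assume s: "scal c s_op (Suc k) \<in> C (Suc k)"
  show "scal c s_op k \<in> C k"
  proof (cases "even k")
    case True
    then show ?thesis using subst_const_last[OF s assms, of 1]
      by (simp add: scal_def s_op_def prodx_Suc_upd sumx_Suc_upd)
  next
    case False
    then show ?thesis using neg[OF subst_const_last[OF s assms, of "-1"]]
      by (simp add: scal_def s_op_def prodx_Suc_upd sumx_Suc_upd)
  qed
qed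

end

section \<open>Assembling the eight joinands\<close>

theorem theorem4p3:
  fixes C :: opfam
  assumes "is_clone C" and "P_add \<le> C" and "C \<le> M1"
  shows "\<exists>n1 n2 n3 n4 n5 n6 n7 n8 :: enat.
    C = clone_Join {joinand 1 (scal 2 t_op) n1, joinand 1 (scal 2 u_op) n2,
                    joinand 2 (scal 2 v_op) n3, joinand 1 (scal 2 s_op) n4,
                    joinand 1 (scal 2 p_op) n5, joinand 1 (scal 2 q_op) n6,
                    joinand 1 (scal 2 r_op) n7, joinand 1 (scal 4 r_op) n8}"
proof -
  have C: "pclone C" using assms(1,2) by (rule pclone.intro)
  obtain n1 where t: "covers C 1 (scal 2 t_op) (joinand 1 (scal 2 t_op) n1)"
    using ex_joinand[OF C order_refl, of "scal 2 t_op"] pclone.special_downward_sum(1) by metis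
  obtain n2 where u: "covers C 1 (scal 2 u_op) (joinand 1 (scal 2 u_op) n2)"
    using ex_joinand[OF C order_refl, of "scal 2 u_op"] pclone.special_downward(2) by metis
  obtain n3 where v: "covers C 2 (scal 2 v_op) (joinand 2 (scal 2 v_op) n3)"
    using ex_joinand[OF C one_le_numeral, of _ "scal 2 v_op"] pclone.special_downward(5)
      order_trans[OF one_le_numeral[of "num.Bit0 num.One"]] by metis
  obtain n4 where s: "covers C 1 (scal 2 s_op) (joinand 1 (scal 2 s_op) n4)"
    using ex_joinand[OF C order_refl, of "scal 2 s_op"] pclone.special_downward_sum(2) by metis
  obtain n5 where p: "covers C 1 (scal 2 p_op) (joinand 1 (scal 2 p_op) n5)"
    using ex_joinand[OF C order_refl, of "scal 2 p_op"] pclone.special_downward(3) by metis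
  obtain n6 where q: "covers C 1 (scal 2 q_op) (joinand 1 (scal 2 q_op) n6)"
    using ex_joinand[OF C order_refl, of "scal 2 q_op"] pclone.special_downward(4) by metis
  obtain n7 where r: "covers C 1 (scal 2 r_op) (joinand 1 (scal 2 r_op) n7)"
    using ex_joinand[OF C order_refl, of "scal 2 r_op"] pclone.special_downward(1) by metis
  obtain n8 where r4: "covers C 1 (scal 4 r_op) (joinand 1 (scal 4 r_op) n8)"
    using ex_joinand[OF C order_refl, of "scal 4 r_op"] pclone.special_downward(1) by metis
  let ?S = "{joinand 1 (scal 2 t_op) n1, joinand 1 (scal 2 u_op) n2,
             joinand 2 (scal 2 v_op) n3, joinand 1 (scal 2 s_op) n4,
             joinand 1 (scal 2 p_op) n5, joinand 1 (scal 2 q_op) n6,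
             joinand 1 (scal 2 r_op) n7, joinand 1 (scal 4 r_op) n8}"
  \<comment> \<open>The bound by \<open>C\<close> ensures that the generated family is a clone and
    lies below \<open>C\<close>.\<close>
  have S: "Sup ?S \<le> C"
    using t u v s p q r r4 by (intro Sup_least) (auto simp only: covers_def insert_iff empty_iff)
  have up: "J \<le> clone_Join ?S" if "J \<in> ?S" for J
    unfolding clone_Join_def by (rule order_trans[OF Sup_upper[OF that] clone_gen_upper])
  have covered: "f k \<in> clone_Join ?S k" if "covers C lo f J" "J \<in> ?S" "lo \<le> k" "f k \<in> C k" for f lo k J
    using that(1,3,4) le_funD[OF up[OF that(2)], of k] unfolding covers_def by blast
  have D: "pclone (clone_Join ?S)"
  proof
    show "is_clone (clone_Join ?S)"
      unfolding clone_Join_def by (rule is_clone_clone_gen[OF assms(1) S])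
    show "P_add \<le> clone_Join ?S"
      using t by (intro order_trans[OF _ up[of "joinand 1 (scal 2 t_op) n1"]]) (simp_all add: covers_def)
  qed
  \<comment> \<open>Each family is covered by its joinand, so the join contains all special
    operations of \<open>C\<close>.\<close>
  have "special_reduct C (clone_Join ?S)"
  proof (intro special_reduct.intro special_reduct_axioms.intro C D)
    show "clone_Join ?S \<le> C"
      unfolding clone_Join_def by (rule clone_gen_least[OF assms(1) S])
  qed (rule covered[OF t] covered[OF u] covered[OF v] covered[OF s] covered[OF p] covered[OF q]
      covered[OF r] covered[OF r4]; simp only: insert_iff simp_thms)+
  then have "C = clone_Join ?S" using assms(3) by (rule special_reduct.eq_of_le_M1)
  then show ?thesis by (intro exI)
qed

end
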